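(* Suppose the setting and standing assumptions (A1)–(A5) of the context hold and $\epsilon>0$ is sufficiently small. Consider one of the half-planes $x>0$ or $x<0$ and let $V=V(\xi)$ be the solution there. If $\lambda^\alpha$ is linearly degenerate, then on the sector $\xi\in I^\alpha$ the function $V$ is either constant, or constant on each side of a single contact discontinuity.
   Context: System. Let $f^x,f^y:\mathcal P\to\mathbb R^m$ ($\mathcal P\subset\mathbb R^m$) be smooth fluxes of the system $U_t+f^x(U)_x+f^y(U)_y=0$, and let $\eta,\psi^x,\psi^y:\mathcal P\to\mathbb R$ be smooth with $\eta_{UU}$ positive definite, $\psi^x_U=\eta_Uf^x_U$, $\psi^y_U=\eta_Uf^y_U$ (subscripts $U$ denote derivatives). An entropy solution is $U\in L^\infty$ satisfying the system in the sense of distributions and $\eta(U)_t+\psi^x(U)_x+\psi^y(U)_y\le 0$ in the sense of distributions. (A1) The system is $U_t+f^x(U)_x+f^y(U)_y=0$ with smooth fluxes $f^x,f^y:\mathcal P\to\mathbb R^m$ and smooth $\eta,\psi^x,\psi^y:\mathcal P\to\mathbb R$ such that $\eta_{UU}$ is positive definite, $\psi^x_U=\eta_Uf^x_U$ and $\psi^y_U=\eta_Uf^y_U$, and $U$ is a steady and self-similar entropy solution: an entropy solution independent of $t$ and constant along rays from the origin of the $(x,y)$-plane. In each of the half-planes $x>0$ and $x<0$, $U$ is thus a function of $\xi=y/x$, and in the sense of distributions $(f^y(U)-\xi f^x(U))_\xi+f^x(U)=0$, with $(\psi^y(U)-\xi\psi^x(U))_\xi+\psi^x(U)\le 0$ for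 $x>0$ and $\ge 0$ for $x<0$. (A2) $U$ takes values in the closed ball of small radius $\epsilon$ around a fixed background state $\overline U$ ($\epsilon$ may be reduced finitely many times). (A3) On this ball, $f^x_U(U)$ is nonsingular and the generalized eigenvalues of the pair $(f^x_U(U),f^y_U(U))$, i.e. the $\lambda$ with $\det(f^y_U-\lambda f^x_U)=0$, are real, semisimple and of constant multiplicity, and there are fewer than $m$ distinct ones. (A4) Each simple eigenvalue is either genuinely nonlinear or linearly degenerate on the whole phase space (definitions below). Eigenvalues of multiplicity $\ge2$ are automatically linearly degenerate. (A5) The eigenvalues of $f^x_U(\overline U)$ are all positive or all negative. Change of variables. $V:=f^x(U)$ is a diffeomorphism near $\overline U$; $\overline V:=f^x(\overline U)$, $f(V):=f^y(U(V))$, $e(V):=\psi^x(U(V))$, $q(V):=\psi^y(U(V))$. The phase space for $V$ is again denoted $\mathcal P_\epsilon$, a small ball around $\overline V$. The eigenvalues of $f_V(V)$ are the generalized eigenvalues above; the distinct ones are $\lambda^1(V)<\dots<\lambda^n(V)$, smooth, with multiplicities $p_\alpha$ and eigenspaces $R^\alpha(V)=\ker(f_V(V)-\lambda^\alpha(V)I)$. $\lambda^\alpha$ is linearly degenerate if $\lambda^\alpha_V(V)r=0$ for all $V\in\mathcal P_\epsilon$, $r\in R^\alpha(V)$; it is genuinely nonlinear if $p_\alpha=1$ and $\lambda^\alpha_V(V)r\neq0$ for all $V\in\mathcal P_\epsilon$, $0\ne r\in R^\alpha(V)$. In each half-plane a version of $V$ is fixed such that for all $\xi_1<\xi_2$: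 $(f(V)-\xi V)|_{\xi_1}^{\xi_2}=-\int_{\xi_1}^{\xi_2}V\,d\eta$, and $(q(V)-\xi e(V))|_{\xi_1}^{\xi_2}\le-\int_{\xi_1}^{\xi_2}e(V)\,d\eta$ for $x>0$, $\ge$ for $x<0$. Sectors. $I^\alpha=\,]\lambda^\alpha(\overline V)-\delta_s,\lambda^\alpha(\overline V)+\delta_s[$, where $\delta_s=\delta_s(\epsilon)>0$, $\delta_s\downarrow0$ as $\epsilon\downarrow0$, and the $I^\alpha$ are pairwise disjoint. Contact discontinuity: a jump at $\xi_0$ between states $V^-\ne V^+$ with $f(V^+)-f(V^-)=\xi_0(V^+-V^-)$, where $V^\pm$ lie on the same leaf of the characteristic foliation of $\lambda^\alpha$ (the foliation of $\mathcal P_\epsilon$ by $p_\alpha$-dimensional submanifolds tangent to the eigenspaces $R^\alpha$) and $\xi_0=\lambda^\alpha(V^-)=\lambda^\alpha(V^+)$. *)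

theory Defs
  imports "HOL-Analysis.Analysis" "HOL-Computational_Algebra.Polynomial"
begin

section \<open>Smooth maps and submanifolds\<close>

text \<open>Meaningful on open sets only, since \<^const>\<open>frechet_derivative\<close> is taken at the full
  neighbourhood filter.\<close>

fun Ck_on :: "nat \<Rightarrow> ('a::real_normed_vector \<Rightarrow> 'b::real_normed_vector) \<Rightarrow> 'a set \<Rightarrow> bool" where
  "Ck_on 0 f S \<longleftrightarrow> continuous_on S f"
| "Ck_on (Suc k) f S \<longleftrightarrow> (\<forall>x\<in>S. f differentiable (at x)) \<and>
     (\<forall>v. Ck_on k (\<lambda>x. frechet_derivative f (at x) v) S)"

definition smooth_on :: "('a::real_normed_vector \<Rightarrow> 'b::real_normed_vector) \<Rightarrow> 'a set \<Rightarrow> bool" where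
  "smooth_on f S \<longleftrightarrow> (\<forall>k. Ck_on k f S)"

text \<open>Embedded submanifolds without boundary, of class $C^1$. (A $C^1$ submanifold tangent to a
  smooth field of subspaces of its own dimension is automatically smooth.)\<close>

definition submanifold :: "nat \<Rightarrow> 'a::euclidean_space set \<Rightarrow> bool" where
  "submanifold k S \<longleftrightarrow> (\<forall>v\<in>S. \<exists>W W' \<Phi> \<Psi> L.
     open W \<and> v \<in> W \<and> open W' \<and> homeomorphism W W' \<Phi> \<Psi> \<and>
     Ck_on 1 \<Phi> W \<and> Ck_on 1 \<Psi> W' \<and>
     subspace (L::'a set) \<and> dim L = k \<and> \<Phi> ` (W \<inter> S) = W' \<inter> L)"

definition tangent_space :: "'a::real_normed_vector set \<Rightarrow> 'a \<Rightarrow> 'a set" where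
  "tangent_space S v = {w. \<exists>\<gamma>::real \<Rightarrow> 'a. \<gamma> 0 = v \<and> range \<gamma> \<subseteq> S \<and> (\<gamma> has_vector_derivative w) (at 0)}"


section \<open>Generalized eigenvalues of a matrix pair\<close>

text \<open>The polynomial $\det(A - X B)$ in the indeterminate $X$.\<close>

definition pencil_poly :: "real^'m^'m \<Rightarrow> real^'m^'m \<Rightarrow> real poly" where
  "pencil_poly B A = det (\<chi> i j. [: A $ i $ j, - (B $ i $ j) :])"

definition gen_eigenvalues :: "real^'m^'m \<Rightarrow> real^'m^'m \<Rightarrow> real set" where
  "gen_eigenvalues B A = {\<mu>. det (A - \<mu> *\<^sub>R B) = 0}"

definition gen_eigenspace :: "real^'m^'m \<Rightarrow> real^'m^'m \<Rightarrow> real \<Rightarrow> (real^'m) set" where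
  "gen_eigenspace B A \<mu> = {v. (A - \<mu> *\<^sub>R B) *v v = 0}"

definition all_gen_eigenvalues_real :: "real^'m^'m \<Rightarrow> real^'m^'m \<Rightarrow> bool" where
  "all_gen_eigenvalues_real B A \<longleftrightarrow>
     (\<forall>z::complex. poly (map_poly complex_of_real (pencil_poly B A)) z = 0 \<longrightarrow> z \<in> \<real>)"

definition gen_eigenvalues_semisimple :: "real^'m^'m \<Rightarrow> real^'m^'m \<Rightarrow> bool" where
  "gen_eigenvalues_semisimple B A \<longleftrightarrow>
     (\<forall>\<mu>\<in>gen_eigenvalues B A. dim (gen_eigenspace B A \<mu>) = order \<mu> (pencil_poly B A))"


section \<open>Entropy systems and entropy solutions\<close>

definition entropy_system ::
  "(real^'m) set \<Rightarrow> (real^'m \<Rightarrow> real^'m) \<Rightarrow> (real^'m \<Rightarrow> real^'m) \<Rightarrow>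
   (real^'m \<Rightarrow> real) \<Rightarrow> (real^'m \<Rightarrow> real) \<Rightarrow> (real^'m \<Rightarrow> real) \<Rightarrow> bool" where
  "entropy_system P fx fy \<eta> \<psi>x \<psi>y \<longleftrightarrow>
     open P \<and> smooth_on fx P \<and> smooth_on fy P \<and>
     smooth_on \<eta> P \<and> smooth_on \<psi>x P \<and> smooth_on \<psi>y P \<and>
     (\<forall>u\<in>P. \<forall>v. v \<noteq> 0 \<longrightarrow>
        frechet_derivative (\<lambda>w. frechet_derivative \<eta> (at w) v) (at u) v > 0) \<and>
     (\<forall>u\<in>P. \<forall>v.
        frechet_derivative \<psi>x (at u) v
          = frechet_derivative \<eta> (at u) (frechet_derivative fx (at u) v) \<and>
        frechet_derivative \<psi>y (at u) v
          = frechet_derivative \<eta> (at u) (frechet_derivative fy (at u) v))"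

text \<open>Points of space-time are triples $(t,x,y)$.\<close>

definition test_function :: "(real \<times> real \<times> real \<Rightarrow> real) \<Rightarrow> bool" where
  "test_function \<phi> \<longleftrightarrow> smooth_on \<phi> UNIV \<and> compact (closure {z. \<phi> z \<noteq> 0})"

definition dt :: "(real \<times> real \<times> real \<Rightarrow> real) \<Rightarrow> real \<times> real \<times> real \<Rightarrow> real" where
  "dt \<phi> z = frechet_derivative \<phi> (at z) (1, 0, 0)"

definition dx :: "(real \<times> real \<times> real \<Rightarrow> real) \<Rightarrow> real \<times> real \<times> real \<Rightarrow> real" where
  "dx \<phi> z = frechet_derivative \<phi> (at z) (0, 1, 0)"

definition dy :: "(real \<times> real \<times> real \<Rightarrow> real) \<Rightarrow> real \<times> real \<times> real \<Rightarrow> real" where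
  "dy \<phi> z = frechet_derivative \<phi> (at z) (0, 0, 1)"

text \<open>The Bochner integrals below are genuine (rather than 0 by default) when the values of \<open>U\<close>
  stay in a compact subset of \<open>P\<close>.\<close>

definition entropy_solution ::
  "(real^'m) set \<Rightarrow> (real^'m \<Rightarrow> real^'m) \<Rightarrow> (real^'m \<Rightarrow> real^'m) \<Rightarrow>
   (real^'m \<Rightarrow> real) \<Rightarrow> (real^'m \<Rightarrow> real) \<Rightarrow> (real^'m \<Rightarrow> real) \<Rightarrow>
   (real \<times> real \<times> real \<Rightarrow> real^'m) \<Rightarrow> bool" where
  "entropy_solution P fx fy \<eta> \<psi>x \<psi>y U \<longleftrightarrow>
     range U \<subseteq> P \<and> U \<in> borel_measurable lebesgue \<and>
     (\<exists>C. AE z in lebesgue. norm (U z) \<le> C) \<and>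
     (\<forall>\<phi>. test_function \<phi> \<longrightarrow>
        (LINT z|lebesgue. dt \<phi> z *\<^sub>R U z + dx \<phi> z *\<^sub>R fx (U z) + dy \<phi> z *\<^sub>R fy (U z)) = 0) \<and>
     (\<forall>\<phi>. test_function \<phi> \<and> (\<forall>z. \<phi> z \<ge> 0) \<longrightarrow>
        (LINT z|lebesgue. dt \<phi> z * \<eta> (U z) + dx \<phi> z * \<psi>x (U z) + dy \<phi> z * \<psi>y (U z)) \<ge> 0)"

definition steady_self_similar :: "(real \<times> real \<times> real \<Rightarrow> 'a) \<Rightarrow> bool" where
  "steady_self_similar U \<longleftrightarrow>
     (\<forall>t t' x y. U (t, x, y) = U (t', x, y)) \<and>
     (\<forall>t x y s. s > 0 \<longrightarrow> U (t, s * x, s * y) = U (t, x, y))"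


section \<open>The half-plane problem in the variable \<open>V = fx U\<close>\<close>

text \<open>A function of \<open>U\<close> near the background state, expressed as a function of \<open>V\<close>;
  \<open>B\<close> is a set on which \<open>fx\<close> is injective.\<close>

definition in_V :: "(real^'m \<Rightarrow> real^'m) \<Rightarrow> (real^'m) set \<Rightarrow> (real^'m \<Rightarrow> 'b) \<Rightarrow> real^'m \<Rightarrow> 'b" where
  "in_V fx B g V = g (the_inv_into B fx V)"

text \<open>\<open>\<sigma> = 1\<close> is the half-plane $x>0$ and \<open>\<sigma> = -1\<close> is $x<0$; the ray $y/x = \<xi>$ in it passes
  through $(\<sigma>, \<sigma>\<xi>)$. \<open>K\<close> is the set of admissible values of \<open>V\<close>.\<close>

definition half_plane_version ::
  "real \<Rightarrow> (real^'m \<Rightarrow> real^'m) \<Rightarrow> (real^'m \<Rightarrow> real^'m) \<Rightarrow> (real^'m \<Rightarrow> real) \<Rightarrow> (real^'m \<Rightarrow> real) \<Rightarrow>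
   (real^'m) set \<Rightarrow> (real \<times> real \<times> real \<Rightarrow> real^'m) \<Rightarrow> (real \<Rightarrow> real^'m) \<Rightarrow> bool" where
  "half_plane_version \<sigma> fx f e q K U V \<longleftrightarrow>
     V \<in> borel_measurable lebesgue \<and> range V \<subseteq> K \<and>
     (AE \<xi> in lebesgue. V \<xi> = fx (U (0, \<sigma>, \<sigma> * \<xi>))) \<and>
     (\<forall>\<xi>1 \<xi>2. \<xi>1 < \<xi>2 \<longrightarrow>
        (f (V \<xi>2) - \<xi>2 *\<^sub>R V \<xi>2) - (f (V \<xi>1) - \<xi>1 *\<^sub>R V \<xi>1) = - integral {\<xi>1..\<xi>2} V) \<and>
     (\<forall>\<xi>1 \<xi>2. \<xi>1 < \<xi>2 \<longrightarrow>
        \<sigma> * ((q (V \<xi>2) - \<xi>2 * e (V \<xi>2)) - (q (V \<xi>1) - \<xi>1 * e (V \<xi>1)))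
          \<le> \<sigma> * (- integral {\<xi>1..\<xi>2} (\<lambda>\<xi>. e (V \<xi>))))"


section \<open>Characteristic fields\<close>

text \<open>In this section \<open>l\<close> is an eigenvalue function of the Jacobian of \<open>f\<close>.\<close>

definition eigenspace :: "(real^'m \<Rightarrow> real^'m) \<Rightarrow> (real^'m \<Rightarrow> real) \<Rightarrow> real^'m \<Rightarrow> (real^'m) set" where
  "eigenspace f l V = {r. frechet_derivative f (at V) r = l V *\<^sub>R r}"

definition linearly_degenerate ::
  "(real^'m) set \<Rightarrow> (real^'m \<Rightarrow> real^'m) \<Rightarrow> (real^'m \<Rightarrow> real) \<Rightarrow> bool" where
  "linearly_degenerate Q f l \<longleftrightarrow>
     (\<forall>V\<in>Q. \<forall>r\<in>eigenspace f l V. frechet_derivative l (at V) r = 0)"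

text \<open>To be used for simple eigenvalues only.\<close>

definition genuinely_nonlinear ::
  "(real^'m) set \<Rightarrow> (real^'m \<Rightarrow> real^'m) \<Rightarrow> (real^'m \<Rightarrow> real) \<Rightarrow> bool" where
  "genuinely_nonlinear Q f l \<longleftrightarrow>
     (\<forall>V\<in>Q. \<forall>r\<in>eigenspace f l V. r \<noteq> 0 \<longrightarrow> frechet_derivative l (at V) r \<noteq> 0)"

text \<open>Two states lie on the same leaf of the characteristic foliation iff some connected integral
  manifold (of full dimension \<open>k\<close>, the multiplicity of \<open>l\<close>) contains both.\<close>

definition integral_manifold ::
  "(real^'m) set \<Rightarrow> (real^'m \<Rightarrow> real^'m) \<Rightarrow> (real^'m \<Rightarrow> real) \<Rightarrow> nat \<Rightarrow> (real^'m) set \<Rightarrow> bool" where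
  "integral_manifold Q f l k S \<longleftrightarrow>
     S \<subseteq> Q \<and> connected S \<and> submanifold k S \<and> (\<forall>V\<in>S. tangent_space S V = eigenspace f l V)"

definition same_leaf ::
  "(real^'m) set \<Rightarrow> (real^'m \<Rightarrow> real^'m) \<Rightarrow> (real^'m \<Rightarrow> real) \<Rightarrow> nat \<Rightarrow> real^'m \<Rightarrow> real^'m \<Rightarrow> bool" where
  "same_leaf Q f l k V W \<longleftrightarrow> (\<exists>S. integral_manifold Q f l k S \<and> V \<in> S \<and> W \<in> S)"

definition contact_discontinuity ::
  "(real^'m) set \<Rightarrow> (real^'m \<Rightarrow> real^'m) \<Rightarrow> (real^'m \<Rightarrow> real) \<Rightarrow> nat \<Rightarrow>
   real \<Rightarrow> real^'m \<Rightarrow> real^'m \<Rightarrow> bool" where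
  "contact_discontinuity Q f l k \<xi>0 Vm Vp \<longleftrightarrow>
     Vm \<noteq> Vp \<and> f Vp - f Vm = \<xi>0 *\<^sub>R (Vp - Vm) \<and>
     same_leaf Q f l k Vm Vp \<and> \<xi>0 = l Vm \<and> \<xi>0 = l Vp"

text \<open>The identities for \<open>V\<close> do not determine its value at a single point: changing \<open>V \<equiv> c\<close> at
  $\<xi> = \<lambda>(c)$ to another state on the leaf of \<open>c\<close> preserves all of them. So the one point where a
  contact could sit is left out, in both cases.\<close>

definition constant_on_sector :: "(real^'m \<Rightarrow> real) \<Rightarrow> real set \<Rightarrow> (real \<Rightarrow> real^'m) \<Rightarrow> bool" where
  "constant_on_sector l I V \<longleftrightarrow> (\<exists>c. \<forall>\<xi>\<in>I. \<xi> \<noteq> l c \<longrightarrow> V \<xi> = c)"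

definition single_contact_on_sector ::
  "(real^'m) set \<Rightarrow> (real^'m \<Rightarrow> real^'m) \<Rightarrow> (real^'m \<Rightarrow> real) \<Rightarrow> nat \<Rightarrow>
   real set \<Rightarrow> (real \<Rightarrow> real^'m) \<Rightarrow> bool" where
  "single_contact_on_sector Q f l k I V \<longleftrightarrow>
     (\<exists>\<xi>0\<in>I. \<exists>Vm Vp. contact_discontinuity Q f l k \<xi>0 Vm Vp \<and>
        (\<forall>\<xi>\<in>I. \<xi> < \<xi>0 \<longrightarrow> V \<xi> = Vm) \<and> (\<forall>\<xi>\<in>I. \<xi> > \<xi>0 \<longrightarrow> V \<xi> = Vp))"


section \<open>Hypotheses on the eigenvalues and the sectors\<close>

text \<open>On the set \<open>B\<close> of states \<open>U\<close>, the distinct generalized eigenvalues are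
  \<open>lam 1 (fx U) < \<dots> < lam n (fx U)\<close>, with multiplicities \<open>p 1, \<dots>, p n\<close> independent of \<open>U\<close>.\<close>

definition hyperbolic_constant_multiplicity ::
  "(real^'m) set \<Rightarrow> (real^'m \<Rightarrow> real^'m) \<Rightarrow> (real^'m \<Rightarrow> real^'m) \<Rightarrow>
   nat \<Rightarrow> (nat \<Rightarrow> real^'m \<Rightarrow> real) \<Rightarrow> (nat \<Rightarrow> nat) \<Rightarrow> bool" where
  "hyperbolic_constant_multiplicity B fx fy n lam p \<longleftrightarrow>
     (\<forall>u\<in>B. let Fx = jacobian fx (at u); Fy = jacobian fy (at u) in
        invertible Fx \<and>
        all_gen_eigenvalues_real Fx Fy \<and>
        gen_eigenvalues_semisimple Fx Fy \<and>
        gen_eigenvalues Fx Fy = (\<lambda>\<alpha>. lam \<alpha> (fx u)) ` {1..n} \<and>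
        strict_mono_on {1..n} (\<lambda>\<alpha>. lam \<alpha> (fx u)) \<and>
        (\<forall>\<alpha>\<in>{1..n}. order (lam \<alpha> (fx u)) (pencil_poly Fx Fy) = p \<alpha>))"

definition sector :: "real \<Rightarrow> real \<Rightarrow> real set" where
  "sector l \<delta> = {l - \<delta> <..< l + \<delta>}"

text \<open>The sector half-widths as a function of the ball radius; \<open>l \<alpha>\<close> is the value of the
  \<open>\<alpha>\<close>-th eigenvalue at the background state.\<close>

definition sector_widths :: "real \<Rightarrow> nat \<Rightarrow> (nat \<Rightarrow> real) \<Rightarrow> (real \<Rightarrow> real) \<Rightarrow> bool" where
  "sector_widths r n l \<delta>s \<longleftrightarrow>
     (\<forall>\<epsilon>\<in>{0<..r}. \<delta>s \<epsilon> > 0) \<and> mono_on {0<..r} \<delta>s \<and> (\<delta>s \<longlongrightarrow> 0) (at_right 0) \<and>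
     (\<forall>\<epsilon>\<in>{0<..r}. \<forall>\<alpha>\<in>{1..n}. \<forall>\<beta>\<in>{1..n}. \<alpha> \<noteq> \<beta> \<longrightarrow>
        sector (l \<alpha>) (\<delta>s \<epsilon>) \<inter> sector (l \<beta>) (\<delta>s \<epsilon>) = {})"

end

(* Freezing the background state \<open>v0\<close> and writing \<open>\<lambda>\<close> for the degenerate eigenvalue, the map
   \<open>g V = f V - \<lambda>(V) (V - v0)\<close> has a derivative that annihilates the \<open>\<lambda>\<close>-eigenspaces. Semisimplicity
   splits the space into the eigenspace at \<open>v0\<close> and a complementary range; the component \<open>a\<close> of \<open>g\<close> in the
   latter is a submersion near \<open>v0\<close> whose level sets are the leaves. In particular \<open>\<lambda>\<close> and \<open>g\<close> are
   functions of \<open>a\<close>, so the profile equation becomes an equation for \<open>g + \<lambda> (V - v0) - \<xi> V\<close>. It makes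
   \<open>a(V(\<xi>))\<close> Lipschitz with a constant controlled by the diameter of the range of \<open>V\<close>; hence
   \<open>\<lambda>(V(\<xi>)) - \<xi>\<close> vanishes at most once, and where it does not vanish \<open>V\<close> has derivative zero. *)

theory Submission
  imports Defs
begin


section \<open>Continuously differentiable maps\<close>

text \<open>Centring at \<open>v0\<close> matters. Subtracting \<open>l v\<close> times
  \<open>v\<close> would kill the eigenvectors as well, but with \<open>v - v0\<close> the
  \<open>l'\<close> term disappears at \<open>v0\<close>: the derivative there is
  \<open>f' v0 - l v0\<close>, the very operator to which semisimplicity applies, and in the jump
  relation a change of \<open>l\<close> enters with the small factor \<open>v - v0\<close>. The
  obstacle is that the profile is merely measurable and bounded, without one-sided limits or a chain
  rule, so every estimate compares two values of \<open>V\<close> directly. As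
  \<open>l (V \<xi>) - \<xi>\<close> tends to 0, the relation loses control of the eigenspace part
  of a jump but not of the transversal part; hence the detour through \<open>a\<close>. The
  constants are ordered accordingly: \<open>C\<close> and \<open>\<delta>\<close> depend on
  \<open>v0\<close> only, and the neighbourhood is shrunk afterwards until its diameter bound
  \<open>D\<close> satisfies \<open>C * C * D \<le> 1/2\<close>. Then \<open>l (V \<xi>)\<close> has
  Lipschitz constant 1/2 in the sector, below the slope 1 of \<open>\<xi>\<close>.\<close>

definition C1_derivative ::
  "('a::real_normed_vector \<Rightarrow> 'b::real_normed_vector) \<Rightarrow> ('a \<Rightarrow> 'a \<Rightarrow>\<^sub>L 'b) \<Rightarrow> 'a set \<Rightarrow> bool" where
  "C1_derivative f f' S \<longleftrightarrow>
     (\<forall>x\<in>S. (f has_derivative blinfun_apply (f' x)) (at x)) \<and> continuous_on S f'"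

lemma C1_derivativeD:
  assumes "C1_derivative f f' S"
  shows "x \<in> S \<Longrightarrow> (f has_derivative blinfun_apply (f' x)) (at x)" and "continuous_on S f'"
  using assms by (auto simp: C1_derivative_def)

lemma C1_derivative_subset: "C1_derivative f f' S \<Longrightarrow> T \<subseteq> S \<Longrightarrow> C1_derivative f f' T"
  unfolding C1_derivative_def using continuous_on_subset by blast

lemma C1_derivative_imp_continuous_on: "C1_derivative f f' S \<Longrightarrow> continuous_on S f"
  unfolding C1_derivative_def
  by (meson continuous_at_imp_continuous_on has_derivative_continuous)

text \<open>In finite dimension, continuity of every directional derivative is continuity of the
  derivative in operator norm, the form in which the inverse function theorem and the quantitative
  bounds use it.\<close>

lemma Ck_on_1_obtain_C1_derivative:
  fixes f :: "'a::euclidean_space \<Rightarrow> 'b::real_normed_vector"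
  assumes "Ck_on 1 f S"
  obtains f' where "C1_derivative f f' S"
proof
  let ?f' = "\<lambda>x. Blinfun (frechet_derivative f (at x))"
  have d: "(f has_derivative frechet_derivative f (at x)) (at x)" if "x \<in> S" for x
    using assms that by (simp add: frechet_derivative_works)
  have e: "blinfun_apply (?f' x) = frechet_derivative f (at x)" if "x \<in> S" for x
    using d[OF that] by (simp add: bounded_linear_Blinfun_apply has_derivative_bounded_linear)
  show "C1_derivative f ?f' S"
    unfolding C1_derivative_def
  proof (intro conjI ballI continuous_on_blinfun_componentwise)
    show "(f has_derivative blinfun_apply (?f' x)) (at x)" if "x \<in> S" for x
      using d e that by simp
    fix i :: 'a
    have "continuous_on S (\<lambda>x. frechet_derivative f (at x) i)"
      using assms by simp
    then show "continuous_on S (\<lambda>x. blinfun_apply (?f' x) i)"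
      by (rule continuous_on_eq) (simp add: e)
  qed
qed

lemma C1_derivative_imp_Ck_on_1:
  assumes "C1_derivative f f' S"
  shows "Ck_on 1 f S"
proof -
  note d = C1_derivativeD(1)[OF assms]
  have "frechet_derivative f (at x) = blinfun_apply (f' x)" if "x \<in> S" for x
    using d[OF that] frechet_derivative_at by metis
  moreover have "continuous_on S (\<lambda>x. blinfun_apply (f' x) v)" for v
    by (intro continuous_intros C1_derivativeD(2)[OF assms])
  ultimately have "continuous_on S (\<lambda>x. frechet_derivative f (at x) v)" for v
    by (simp cong: continuous_on_cong)
  then show ?thesis
    using d by (auto simp: differentiable_def)
qed

lemma C1_derivative_compose:
  assumes f: "C1_derivative f f' S" and g: "C1_derivative g g' T" and "g ` T \<subseteq> S"
  shows "C1_derivative (\<lambda>x. f (g x)) (\<lambda>x. f' (g x) o\<^sub>L g' x) T"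
  unfolding C1_derivative_def
proof (intro conjI ballI)
  fix x assume "x \<in> T"
  then show "((\<lambda>x. f (g x)) has_derivative blinfun_apply (f' (g x) o\<^sub>L g' x)) (at x)"
    using has_derivative_compose[OF C1_derivativeD(1)[OF g] C1_derivativeD(1)[OF f], of x] assms(3)
    by (auto simp: blinfun_compose.rep_eq comp_def)
next
  show "continuous_on T (\<lambda>x. f' (g x) o\<^sub>L g' x)"
    by (intro continuous_intros continuous_on_compose2[OF C1_derivativeD(2)[OF f]]
        C1_derivative_imp_continuous_on[OF g] C1_derivativeD(2)[OF g] assms(3))
qed

text \<open>A lower bound \<open>c\<close> for \<open>F x0\<close> survives as \<open>c / 2\<close>
  for all \<open>F x\<close> within operator distance \<open>c / 2\<close>. Applied to the
  difference of the preimages of a fixed \<open>v\<close>, it bounds that difference by the change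
  of \<open>F\<close> at one fixed vector.\<close>

lemma continuous_on_inv_blinfun:
  fixes F :: "'c::t2_space \<Rightarrow> 'a::euclidean_space \<Rightarrow>\<^sub>L 'a"
  assumes cont: "continuous_on S F" and inj: "\<And>x. x \<in> S \<Longrightarrow> inj (blinfun_apply (F x))"
  shows "continuous_on S (\<lambda>x. Blinfun (inv (blinfun_apply (F x))))"
    and "x \<in> S \<Longrightarrow> blinfun_apply (Blinfun (inv (blinfun_apply (F x)))) = inv (blinfun_apply (F x))"
    and "x \<in> S \<Longrightarrow> bij (blinfun_apply (F x))"
proof -
  have lin: "linear (blinfun_apply (F x))" for x
    by (simp add: blinfun.bounded_linear_right bounded_linear.linear)
  show bij: "bij (blinfun_apply (F x))" if "x \<in> S" for x
    using lin inj[OF that] by (simp add: bij_def linear_injective_imp_surjective)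
  have "linear (inv (blinfun_apply (F x)))" if "x \<in> S" for x
    using inj_linear_imp_inv_linear[OF lin inj[OF that]] .
  then show app: "blinfun_apply (Blinfun (inv (blinfun_apply (F x)))) = inv (blinfun_apply (F x))"
    if "x \<in> S" for x
    using that by (simp add: bounded_linear_Blinfun_apply linear_conv_bounded_linear)
  have "continuous_on S (\<lambda>x. inv (blinfun_apply (F x)) v)" for v
    unfolding continuous_on_def
  proof
    fix x0 assume x0: "x0 \<in> S"
    define w where "w x = inv (blinfun_apply (F x)) v" for x
    have Fw: "F x (w x) = v" if "x \<in> S" for x
      using bij[OF that] by (simp add: w_def bij_is_surj surj_f_inv_f)
    obtain c where c: "c > 0" "\<And>z. c * norm z \<le> norm (F x0 z)"
      using linear_inj_bounded_below_pos[OF lin inj[OF x0]] by blast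
    have lim: "(F \<longlongrightarrow> F x0) (at x0 within S)"
      using cont x0 by (simp add: continuous_on_def)
    have "\<forall>\<^sub>F x in at x0 within S. dist (F x) (F x0) < c / 2"
      using lim c(1) by (intro tendstoD) auto
    moreover have "\<forall>\<^sub>F x in at x0 within S. x \<in> S"
      by (simp add: eventually_at_topological) blast
    ultimately have "\<forall>\<^sub>F x in at x0 within S.
      norm (w x - w x0) \<le> norm (F x0 (w x0) - F x (w x0)) * (2 / c)"
    proof eventually_elim
      case (elim x)
      have "c * norm (w x - w x0) \<le> norm (F x0 (w x - w x0))"
        by (rule c)
      also have "\<dots> \<le> norm (F x (w x - w x0)) + norm ((F x0 - F x) (w x - w x0))"
        by (simp add: blinfun.diff_left norm_triangle_sub add.commute)
      also have "norm ((F x0 - F x) (w x - w x0)) \<le> c / 2 * norm (w x - w x0)"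
        using elim(1)
        by (intro order_trans[OF norm_blinfun] mult_right_mono) (auto simp: dist_norm norm_minus_commute)
      also have "F x (w x - w x0) = F x0 (w x0) - F x (w x0)"
        using Fw elim(2) x0 by (simp add: blinfun.diff_right)
      finally show ?case
        using c(1) by (simp add: field_simps)
    qed
    moreover have "((\<lambda>x. norm (F x0 (w x0) - F x (w x0)) * (2 / c)) \<longlongrightarrow>
        norm (F x0 (w x0) - F x0 (w x0)) * (2 / c)) (at x0 within S)"
      by (intro tendsto_intros lim)
    ultimately have "((\<lambda>x. w x - w x0) \<longlongrightarrow> 0) (at x0 within S)"
      by (intro Lim_null_comparison[of "\<lambda>x. w x - w x0"]) simp_all
    then show "((\<lambda>x. inv (blinfun_apply (F x)) v) \<longlongrightarrow> inv (blinfun_apply (F x0)) v) (at x0 within S)"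
      unfolding w_def by (simp add: LIM_zero_iff)
  qed
  then have "continuous_on S (\<lambda>x. blinfun_apply (Blinfun (inv (blinfun_apply (F x)))) v)" for v
    by (rule continuous_on_eq) (simp add: app)
  then show "continuous_on S (\<lambda>x. Blinfun (inv (blinfun_apply (F x))))"
    by (intro continuous_on_blinfun_componentwise)
qed

lemma poly_pencil_poly: "poly (pencil_poly B A) t = det (A - t *\<^sub>R B)"
  unfolding pencil_poly_def det_def
  by (simp add: poly_sum poly_prod poly_mult)


section \<open>Semisimple generalized eigenvalues\<close>

text \<open>Otherwise \<open>v\<close>, \<open>w\<close> would be a Jordan chain of length two. Then
  \<open>v\<close> and a basis of the eigenspace are independent and number one more than the order
  of \<open>\<mu>\<close>, yet each of them contributes a factor \<open>s\<close> to the determinant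
  of the pencil at \<open>\<mu> + s\<close>.\<close>

lemma semisimple_gen_eigenvalue_transversal:
  fixes A B :: "real^'m^'m"
  assumes semisimple: "dim (gen_eigenspace B A \<mu>) = order \<mu> (pencil_poly B A)"
    and nonzero: "pencil_poly B A \<noteq> 0"
    and w: "w \<in> gen_eigenspace B A \<mu>" and v: "(A - \<mu> *\<^sub>R B) *v v = B *v w"
  shows "B *v w = 0"
proof (rule ccontr)
  assume "B *v w \<noteq> 0"
  define E where "E = gen_eigenspace B A \<mu>"
  define N where "N s = A - (\<mu> + s) *\<^sub>R B" for s
  have Nv: "N s *v x = (A - \<mu> *\<^sub>R B) *v x - s *\<^sub>R (B *v x)" for s x
    by (simp add: N_def matrix_vector_mult_diff_rdistrib scaleR_left_distrib
        matrix_vector_mult_add_rdistrib scaleR_matrix_vector_assoc)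
  have "subspace E"
    unfolding E_def gen_eigenspace_def
    by (auto simp: subspace_def matrix_vector_right_distrib matrix_vector_mult_scaleR)
  obtain B0 where B0: "B0 \<subseteq> E" "independent B0" "E \<subseteq> span B0" "card B0 = dim E"
    using basis_exists by blast
  have E: "(A - \<mu> *\<^sub>R B) *v x = 0 \<longleftrightarrow> x \<in> E" for x
    by (simp add: E_def gen_eigenspace_def)
  have spanB0: "span B0 = E"
    using B0 \<open>subspace E\<close> by (simp add: span_minimal subset_antisym)
  have "v \<notin> E"
    using \<open>B *v w \<noteq> 0\<close> v E[of v] by auto
  then have "independent (insert v B0)"
    using B0 spanB0 by (simp add: independent_insertI)
  then obtain B1 where B1: "insert v B0 \<subseteq> B1" "independent B1" "span B1 = UNIV"
    by (metis maximal_independent_subset_extend subset_UNIV top.extremum_uniqueI)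
  have "card B1 = CARD('m)" "finite B1"
    using dim_span_eq_card_independent[OF B1(2)] independent_imp_finite[OF B1(2)]
    by (simp_all add: B1(3))
  then obtain b where b: "bij_betw b (UNIV::'m set) B1"
    using finite_same_card_bij[of "UNIV::'m set" B1] by auto
  then obtain j0 where j0: "b j0 = v"
    using B1(1) by (metis bij_betw_imp_surj_on image_iff insert_subset)
  define J where "J = b -` insert v B0"
  have "inj b"
    using b by (simp add: bij_betw_def)
  have "finite B0" "v \<notin> B0"
    using B0 \<open>v \<notin> E\<close> by (auto intro: independent_imp_finite)
  have "card J = card (insert v B0)"
    unfolding J_def using \<open>inj b\<close> b B1(1)
    by (intro card_vimage_inj) (auto simp: bij_betw_def)
  then have cardJ: "card J = Suc (order \<mu> (pencil_poly B A))"
    using \<open>finite B0\<close> \<open>v \<notin> B0\<close> B0(4) semisimple by (simp add: E_def)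

  \<comment> \<open>The basis vectors are stored as rows, so that \<open>N s\<close> acts on them in
    the rows of \<open>S ** transpose (N s)\<close> and the row rules for determinants
    apply.\<close>
  define S where "S = (\<chi> i. b i)"
  have rowS: "row i S = b i" for i
    by (simp add: S_def row_def vec_eq_iff)
  have "rows S = B1"
    using b by (auto simp: rows_def rowS bij_betw_def)
  then have detS: "det S \<noteq> 0"
    using B1(3) matrix_left_invertible_span_rows_gen[of S]
    by (metis invertible_det_nz invertible_left_inverse span_vec_eq)
  define D where "D s = det (\<chi> i. if i \<in> J then B *v b i else N s *v b i)" for s
  \<comment> \<open>The column operation \<open>v \<mapsto> v + w / s\<close> makes \<open>N s\<close> act on \<open>v\<close> as \<open>- s B\<close>, just as on \<open>E\<close>,
    so that \<open>det (N s)\<close> has one factor \<open>s\<close> more than the multiplicity allows.\<close>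
  have factor: "det (N s) * det S = (-s) ^ card J * D s" if "s \<noteq> 0" for s
  proof -
    let ?S = "\<chi> k. if k = j0 then row j0 S + (1/s) *\<^sub>R w else row k S"
    have "w \<in> span B0"
      using w spanB0 by (simp add: E_def)
    moreover have "B0 \<subseteq> {row j S |j. j \<noteq> j0}"
    proof
      fix x assume "x \<in> B0"
      then obtain j where "x = b j"
        using b B1(1) by (auto simp: bij_betw_def)
      with \<open>x \<in> B0\<close> \<open>v \<notin> B0\<close> j0 show "x \<in> {row j S |j. j \<noteq> j0}"
        unfolding rowS by blast
    qed
    ultimately have "(1/s) *\<^sub>R w \<in> span {row j S |j. j \<noteq> j0}"
      by (intro span_scale) (rule subsetD[OF span_mono])
    then have "(1/s) *\<^sub>R w \<in> vec.span {row j S |j. j \<noteq> j0}"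
      by (simp only: span_vec_eq)
    then have "det ?S = det S"
      by (rule det_row_span)
    moreover have "?S ** transpose (N s) =
      (\<chi> i. (if i \<in> J then -s else 1) *s (if i \<in> J then B *v b i else N s *v b i))"
    proof -
      have "row i (?S ** transpose (N s)) = N s *v row i ?S" for i
        by (simp add: row_def vec_eq_iff matrix_matrix_mult_def matrix_vector_mult_def
            transpose_def mult.commute)
      moreover have "N s *v row i ?S =
        (if i \<in> J then -s else 1) *s (if i \<in> J then B *v b i else N s *v b i)" for i
      proof -
        have ri: "row i ?S = (if i = j0 then v + (1/s) *\<^sub>R w else b i)"
          by (simp add: row_def vec_eq_iff S_def j0)
        have "N s *v (v + (1/s) *\<^sub>R w) = - s *\<^sub>R (B *v v)"
          using v w[folded E_def] E[of w] \<open>s \<noteq> 0\<close>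
          by (simp add: Nv matrix_vector_right_distrib matrix_vector_mult_scaleR
              scaleR_right_distrib)
        moreover have "N s *v b i = - s *\<^sub>R (B *v b i)" if "b i \<in> B0"
          using that B0(1) E by (auto simp: Nv)
        moreover have "b i \<noteq> v" if "i \<noteq> j0"
          using that j0 \<open>inj b\<close> by (auto dest: injD)
        ultimately show ?thesis
          unfolding ri using j0 by (auto simp: J_def scalar_mult_eq_scaleR)
      qed
      ultimately show ?thesis
        by (simp add: vec_eq_iff row_def)
    qed
    then have "det (?S ** transpose (N s)) = (\<Prod>i\<in>UNIV. if i \<in> J then -s else 1) * D s"
      unfolding D_def by (simp only: det_rows_mul)
    moreover have "(\<Prod>i\<in>UNIV. if i \<in> J then -s else 1) = (-s) ^ card J"
      by (simp add: prod.If_cases)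
    ultimately show ?thesis
      by (simp add: det_mul mult.commute)
  qed

  \<comment> \<open>\<open>det (N s)\<close> has a zero of order exactly \<open>k\<close> at
    \<open>s = 0\<close> by the decomposition of the polynomial, but of order at least
    \<open>k + 1\<close> by \<open>factor\<close>. Dividing by \<open>s ^ k\<close> and letting
    \<open>s\<close> tend to 0, with \<open>D\<close> continuous, forces
    \<open>poly q \<mu> * det S = 0\<close>.\<close>
  define k where "k = order \<mu> (pencil_poly B A)"
  obtain q where q: "pencil_poly B A = [:-\<mu>, 1:] ^ k * q" "\<not> [:-\<mu>, 1:] dvd q"
    using order_decomp[OF nonzero] unfolding k_def by blast
  then have "poly q \<mu> \<noteq> 0"
    by (simp add: poly_eq_0_iff_dvd)
  have detN: "det (N s) = s ^ k * poly q (\<mu> + s)" for s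
    using poly_pencil_poly[of B A "\<mu> + s"] unfolding N_def q(1) by simp
  have "poly q (\<mu> + s) * det S = (-1) ^ Suc k * s * D s" if "s \<noteq> 0" for s
  proof -
    have "s ^ k * (poly q (\<mu> + s) * det S) = s ^ k * ((-1) ^ Suc k * s * D s)"
      using factor[OF that] unfolding detN cardJ k_def[symmetric] power_minus[of s]
      by (simp add: mult_ac)
    then show ?thesis
      using that by (metis mult_left_cancel power_not_zero)
  qed
  moreover have "((\<lambda>s. poly q (\<mu> + s) * det S) \<longlongrightarrow> poly q (\<mu> + 0) * det S) (at 0)"
    by (intro tendsto_intros)
  ultimately have "((\<lambda>s. (-1) ^ Suc k * s * D s) \<longlongrightarrow> poly q \<mu> * det S) (at 0)"
    by (subst tendsto_cong[where g = "\<lambda>s. poly q (\<mu> + s) * det S"])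
      (auto simp: eventually_at_filter)
  moreover have "((\<lambda>s. (-1) ^ Suc k * s * D s) \<longlongrightarrow> (-1) ^ Suc k * 0 * D 0) (at 0)"
  proof -
    have "((\<lambda>s. N s *v x) \<longlongrightarrow> N 0 *v x) (at 0)" for x
      unfolding Nv by (auto intro!: tendsto_eq_intros)
    then have "(D \<longlongrightarrow> D 0) (at 0)"
      unfolding D_def det_def by (auto intro!: tendsto_intros)
    then show ?thesis
      by (intro tendsto_intros)
  qed
  ultimately have "poly q \<mu> * det S = 0"
    using tendsto_unique[OF trivial_limit_at] by fastforce
  then show False
    using \<open>poly q \<mu> \<noteq> 0\<close> detS by simp
qed


section \<open>Leaves of a linearly degenerate field\<close>

text \<open>\<open>P\<close> is the projection onto the kernel along the range. The hypothesis makes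
  \<open>T\<close> injective on its range, hence by dimension bijective there, which splits the
  space.\<close>

lemma kernel_range_projection:
  fixes T :: "'a::euclidean_space \<Rightarrow> 'a"
  assumes "linear T" and transversal: "\<And>x. T (T x) = 0 \<Longrightarrow> T x = 0"
  obtains P :: "'a \<Rightarrow>\<^sub>L 'a"
  where "\<And>x. P (T x) = 0" "\<And>x. T (P x) = 0" "\<And>x. T x = 0 \<Longrightarrow> P x = x"
proof -
  interpret T: linear T by fact
  have "inj_on T (range T)"
  proof (rule inj_onI)
    fix u v assume "u \<in> range T" "v \<in> range T" "T u = T v"
    then obtain x y where "u = T x" "v = T y" "T (T (x - y)) = 0"
      by (auto simp: T.diff)
    with transversal[of "x - y"] show "u = v"
      by (simp add: T.diff)
  qed
  have "range T = T ` range T"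
  proof (rule sym, rule subspace_dim_equal)
    show "subspace (T ` range T)" "subspace (range T)"
      by (simp_all add: linear_subspace_image \<open>linear T\<close>)
    show "dim (range T) \<le> dim (T ` range T)"
      using \<open>inj_on T (range T)\<close> \<open>linear T\<close>
      by (metis dim_image_eq linear_subspace_image order_refl span_eq_iff subspace_UNIV)
  qed auto
  then have "\<forall>x. \<exists>y. T (T y) = T x"
    by (metis (mono_tags, lifting) image_iff rangeI)
  \<comment> \<open>\<open>h\<close> is an arbitrary choice of preimages; only
    \<open>T (h x)\<close> is determined by \<open>x\<close>, and that is why
    \<open>x - T (h x)\<close> is linear.\<close>
  then obtain h where h: "\<And>x. T (T (h x)) = T x"
    by metis
  have unique: "T z = T (h x)" if "T (T z) = T x" for x z
    using transversal[of "z - h x"] that h by (simp add: T.diff)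
  have "linear (\<lambda>x. x - T (h x))"
  proof
    show "x + y - T (h (x + y)) = x - T (h x) + (y - T (h y))" for x y
    proof -
      have "T (h (x + y)) = T (h x) + T (h y)"
        using unique[of "h x + h y" "x + y"] by (simp add: T.add h)
      then show ?thesis
        by simp
    qed
    show "c *\<^sub>R x - T (h (c *\<^sub>R x)) = c *\<^sub>R (x - T (h x))" for c x
      using unique[of "c *\<^sub>R h x" "c *\<^sub>R x"] by (simp add: T.scale h scaleR_diff_right)
  qed
  then have P: "blinfun_apply (Blinfun (\<lambda>x. x - T (h x))) x = x - T (h x)" for x
    by (simp add: bounded_linear_Blinfun_apply linear_conv_bounded_linear)
  show thesis
  proof (rule that[of "Blinfun (\<lambda>x. x - T (h x))"], unfold P)
    show "T x - T (h (T x)) = 0" for x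
      using unique[of x "T x"] by simp
    show "T (x - T (h x)) = 0" for x
      by (simp add: T.diff h)
    show "x - T (h x) = x" if "T x = 0" for x
      using unique[of 0 x] that by simp
  qed
qed

text \<open>\<open>P\<close> projects onto the eigenspace at \<open>v0\<close> along the range of
  \<open>f' v0 - l v0\<close>, and stays frozen there. Of the eigenspaces at other points only their
  constant dimension and the degeneracy enter, so no smooth frame of eigenvectors has to be
  built.\<close>

locale degenerate_field =
  fixes f :: "'a::euclidean_space \<Rightarrow> 'a" and f' :: "'a \<Rightarrow> 'a \<Rightarrow>\<^sub>L 'a"
    and l :: "'a \<Rightarrow> real" and l' :: "'a \<Rightarrow> 'a \<Rightarrow>\<^sub>L real"
    and Q :: "'a set" and v0 :: 'a and k :: nat and P :: "'a \<Rightarrow>\<^sub>L 'a"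
  assumes Q: "open Q" "v0 \<in> Q"
    and f: "C1_derivative f f' Q" and l: "C1_derivative l l' Q"
    and dim_eigenspace: "\<And>v. v \<in> Q \<Longrightarrow> dim {r. f' v r = l v *\<^sub>R r} = k"
    and degenerate: "\<And>v r. v \<in> Q \<Longrightarrow> f' v r = l v *\<^sub>R r \<Longrightarrow> l' v r = 0"
    and P_range: "\<And>x. P (f' v0 x - l v0 *\<^sub>R x) = 0"
    and eigen_P: "\<And>x. f' v0 (P x) = l v0 *\<^sub>R P x"
    and P_eigen: "\<And>x. f' v0 x = l v0 *\<^sub>R x \<Longrightarrow> P x = x"
begin

text \<open>By degeneracy the derivative of \<open>g\<close> annihilates the eigenspaces, so the level sets of
  the submersion \<open>a\<close> are integral manifolds: no Frobenius theorem is needed.\<close>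

definition g :: "'a \<Rightarrow> 'a" where
  "g v = f v - l v *\<^sub>R (v - v0)"

definition g' :: "'a \<Rightarrow> 'a \<Rightarrow>\<^sub>L 'a" where
  "g' v = f' v - (l v *\<^sub>R id_blinfun + (blinfun_scaleR_left (v - v0) o\<^sub>L l' v))"

definition a :: "'a \<Rightarrow> 'a" where
  "a v = g v - P (g v)"

text \<open>Coordinates that straighten the foliation: \<open>a\<close> transversal to the leaves
  and \<open>P\<close> along them. Since \<open>P\<close> annihilates \<open>a\<close>, both parts
  can be read off from \<open>\<Theta> v\<close>.\<close>

definition \<Theta> :: "'a \<Rightarrow> 'a" where
  "\<Theta> v = a v + P v"

definition \<Theta>' :: "'a \<Rightarrow> 'a \<Rightarrow>\<^sub>L 'a" where
  "\<Theta>' v = g' v - (P o\<^sub>L g' v) + P"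

lemma g'_apply: "g' v x = f' v x - (l v *\<^sub>R x + l' v x *\<^sub>R (v - v0))"
  by (simp add: g'_def blinfun.bilinear_simps)

lemma g'_eigen: "v \<in> Q \<Longrightarrow> f' v r = l v *\<^sub>R r \<Longrightarrow> g' v r = 0"
  by (simp add: g'_apply degenerate)

lemma P_P [simp]: "P (P x) = P x"
  by (simp add: P_eigen eigen_P)

lemma P_a [simp]: "P (a v) = 0"
  by (simp add: a_def blinfun.diff_right)

lemma P_\<Theta> [simp]: "P (\<Theta> v) = P v"
  by (simp add: \<Theta>_def blinfun.add_right)

lemma C1_g: "C1_derivative g g' Q"
  unfolding C1_derivative_def
proof (intro conjI ballI)
  fix v assume "v \<in> Q"
  note [derivative_intros] = C1_derivativeD(1)[OF f this] C1_derivativeD(1)[OF l this]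
  show "(g has_derivative blinfun_apply (g' v)) (at v)"
    unfolding g_def
    by (rule has_derivative_eq_rhs, (rule derivative_intros)+) (auto simp: g'_apply)
next
  show "continuous_on Q g'"
    unfolding g'_def
    by (intro continuous_intros C1_derivativeD(2)[OF f] C1_derivativeD(2)[OF l]
        C1_derivative_imp_continuous_on[OF l])
qed

lemma C1_\<Theta>: "C1_derivative \<Theta> \<Theta>' Q"
  unfolding C1_derivative_def
proof (intro conjI ballI)
  fix v assume "v \<in> Q"
  note [derivative_intros] = C1_derivativeD(1)[OF C1_g this]
  show "(\<Theta> has_derivative blinfun_apply (\<Theta>' v)) (at v)"
    unfolding \<Theta>_def a_def
    by (rule has_derivative_eq_rhs, (rule derivative_intros)+)
      (auto simp: \<Theta>'_def blinfun.bilinear_simps)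
next
  show "continuous_on Q \<Theta>'"
    unfolding \<Theta>'_def by (intro continuous_intros C1_derivativeD(2)[OF C1_g])
qed

lemma \<Theta>'_v0: "\<Theta>' v0 x = f' v0 x - l v0 *\<^sub>R x + P x"
  using P_range[of x] by (simp add: \<Theta>'_def g'_apply blinfun.bilinear_simps)

text \<open>The derivative at \<open>v0\<close> is \<open>T + P\<close> with
  \<open>T = f' v0 - l v0\<close>. Applying \<open>P\<close> leaves \<open>P x\<close>; once this
  vanishes, so does \<open>T x\<close>, and the kernel of \<open>T\<close> is fixed by
  \<open>P\<close>.\<close>

lemma inj_\<Theta>'_v0: "inj (blinfun_apply (\<Theta>' v0))"
proof -
  have "x = 0" if "\<Theta>' v0 x = 0" for x
  proof -
    have "P (\<Theta>' v0 x) = P x"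
      using P_range[of x] by (simp add: \<Theta>'_v0 blinfun.add_right)
    then have "P x = 0"
      using that by simp
    then show "x = 0"
      using that P_eigen[of x] by (simp add: \<Theta>'_v0)
  qed
  then show ?thesis
    by (simp add: linear_injective_0 bounded_linear.linear blinfun.bounded_linear_right)
qed

text \<open>The inverse function theorem, with the domain cut down so that the image is a ball:
  slices of a ball are convex, which later yields connected leaves.\<close>

lemma chart:
  obtains W \<rho> \<Psi> where "open W" "W \<subseteq> Q" "v0 \<in> W" "\<rho> > 0" "homeomorphism W (ball (\<Theta> v0) \<rho>) \<Theta> \<Psi>"
    "\<And>v. v \<in> W \<Longrightarrow> bij (blinfun_apply (\<Theta>' v))"
    "C1_derivative \<Psi> (\<lambda>y. Blinfun (inv (blinfun_apply (\<Theta>' (\<Psi> y))))) (ball (\<Theta> v0) \<rho>)"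
proof -
  let ?i = "Blinfun (inv (blinfun_apply (\<Theta>' v0)))"
  have "blinfun_apply ?i = inv (blinfun_apply (\<Theta>' v0))"
    by (rule continuous_on_inv_blinfun(2)[of "{v0}"]) (simp_all add: inj_\<Theta>'_v0)
  then have "?i o\<^sub>L \<Theta>' v0 = id_blinfun"
    by (intro blinfun_eqI) (simp add: inj_\<Theta>'_v0)
  from inverse_function_theorem[OF Q(1) C1_derivativeD(1)[OF C1_\<Theta>] C1_derivativeD(2)[OF C1_\<Theta>] Q(2) this]
  obtain U V \<Psi> \<Psi>' where U: "open U" "U \<subseteq> Q" "v0 \<in> U" and V: "open V" "\<Theta> v0 \<in> V"
    and hom: "homeomorphism U V \<Theta> \<Psi>"
    and d: "\<And>y. y \<in> V \<Longrightarrow> (\<Psi> has_derivative \<Psi>' y) (at y)"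
      "\<And>y. y \<in> V \<Longrightarrow> \<Psi>' y = inv (blinfun_apply (\<Theta>' (\<Psi> y)))"
      "\<And>y. y \<in> V \<Longrightarrow> bij (blinfun_apply (\<Theta>' (\<Psi> y)))"
    by metis
  obtain \<rho> where \<rho>: "\<rho> > 0" "ball (\<Theta> v0) \<rho> \<subseteq> V"
    using V open_contains_ball by blast
  let ?B = "ball (\<Theta> v0) \<rho>"
  define W where "W = U \<inter> \<Theta> -` ?B"
  have "W \<subseteq> U"
    by (simp add: W_def)
  have *: "\<Theta> ` W = ?B"
    using homeomorphism_image1[OF hom] \<rho>(2) by (auto simp: W_def)
  have homW: "homeomorphism W ?B \<Theta> \<Psi>"
    by (rule homeomorphism_of_subsets[OF hom \<open>W \<subseteq> U\<close> \<rho>(2) *])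
  show thesis
  proof
    show "open W"
      unfolding W_def by (intro continuous_open_preimage homeomorphism_cont1[OF hom] U) simp
    show "W \<subseteq> Q" "v0 \<in> W" "\<rho> > 0" "homeomorphism W ?B \<Theta> \<Psi>"
      using \<open>W \<subseteq> U\<close> U \<rho>(1) homW by (auto simp: W_def)
    show bij: "bij (blinfun_apply (\<Theta>' v))" if "v \<in> W" for v
      using d(3)[of "\<Theta> v"] that \<rho>(2) homeomorphism_apply1[OF homW that] * by auto
    have \<Psi>W: "\<Psi> ` ?B \<subseteq> W"
      using homeomorphism_image2[OF homW] by simp
    have "continuous_on ?B (\<lambda>y. \<Theta>' (\<Psi> y))"
      using \<Psi>W \<open>W \<subseteq> U\<close> U(2)
      by (intro continuous_on_compose2[OF C1_derivativeD(2)[OF C1_\<Theta>]] homeomorphism_cont2[OF homW])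
        blast
    moreover have "inj (blinfun_apply (\<Theta>' (\<Psi> y)))" if "y \<in> ?B" for y
      using bij \<Psi>W that by (meson bij_is_inj image_subset_iff)
    ultimately show "C1_derivative \<Psi> (\<lambda>y. Blinfun (inv (blinfun_apply (\<Theta>' (\<Psi> y))))) ?B"
      using continuous_on_inv_blinfun(1,2)[of ?B "\<lambda>y. \<Theta>' (\<Psi> y)"] d(1,2) \<rho>(2)
      unfolding C1_derivative_def by (simp add: subset_iff)
  qed
qed

end

section \<open>Eigenspaces and functions of \<open>a\<close> in the straightening chart\<close>

locale degenerate_chart = degenerate_field +
  fixes W :: "'a set" and \<rho> :: real and \<Psi> :: "'a \<Rightarrow> 'a"
  assumes W: "open W" "W \<subseteq> Q" "v0 \<in> W" and \<rho>: "\<rho> > 0"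
    and homeo: "homeomorphism W (ball (\<Theta> v0) \<rho>) \<Theta> \<Psi>"
    and bij_\<Theta>': "\<And>v. v \<in> W \<Longrightarrow> bij (blinfun_apply (\<Theta>' v))"
    and C1_\<Psi>: "C1_derivative \<Psi> (\<lambda>y. Blinfun (inv (blinfun_apply (\<Theta>' (\<Psi> y))))) (ball (\<Theta> v0) \<rho>)"
begin

definition \<Psi>' :: "'a \<Rightarrow> 'a \<Rightarrow>\<^sub>L 'a" where
  "\<Psi>' y = Blinfun (inv (blinfun_apply (\<Theta>' (\<Psi> y))))"

lemmas \<Theta>\<Psi> = homeomorphism_apply2[OF homeo]
lemmas \<Psi>\<Theta> = homeomorphism_apply1[OF homeo]

lemma \<Psi>_in_W: "y \<in> ball (\<Theta> v0) \<rho> \<Longrightarrow> \<Psi> y \<in> W"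
  using homeomorphism_image2[OF homeo] by blast

lemma \<Theta>_in_ball: "v \<in> W \<Longrightarrow> \<Theta> v \<in> ball (\<Theta> v0) \<rho>"
  using homeomorphism_image1[OF homeo] by blast

lemma \<Psi>'_apply: "y \<in> ball (\<Theta> v0) \<rho> \<Longrightarrow> blinfun_apply (\<Psi>' y) = inv (blinfun_apply (\<Theta>' (\<Psi> y)))"
  unfolding \<Psi>'_def
  by (rule continuous_on_inv_blinfun(2)[of "{\<Psi> y}"]) (simp_all add: bij_\<Theta>' \<Psi>_in_W bij_is_inj)

lemma \<Theta>'_\<Psi>': "y \<in> ball (\<Theta> v0) \<rho> \<Longrightarrow> \<Theta>' (\<Psi> y) (\<Psi>' y x) = x"
  by (simp add: \<Psi>'_apply bij_\<Theta>' \<Psi>_in_W bij_is_surj surj_f_inv_f)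

lemma subspace_eigen: "subspace {r. f' v r = l v *\<^sub>R r}"
  by (auto simp: subspace_def blinfun.bilinear_simps scaleR_right_distrib)

lemma fixed_P_eq: "{r. P r = r} = {r. f' v0 r = l v0 *\<^sub>R r}"
  using P_eigen eigen_P by (metis (mono_tags, opaque_lifting))

text \<open>On an eigenvector \<open>r\<close> at \<open>v\<close> the derivative of
  \<open>g\<close> vanishes, so \<open>\<Theta>' v r = P r\<close>. Thus \<open>\<Theta>' v\<close>
  maps the eigenspace at \<open>v\<close> into the fixed space of \<open>P\<close>, and constant
  multiplicity makes the inclusion an equality. In the chart all eigenspaces are one and the same
  subspace.\<close>

lemma eigen_iff:
  assumes "v \<in> W"
  shows "f' v x = l v *\<^sub>R x \<longleftrightarrow> P (\<Theta>' v x) = \<Theta>' v x"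
proof -
  let ?E = "{r. f' v r = l v *\<^sub>R r}" and ?R = "{r. P r = r}"
  have "v \<in> Q"
    using assms W by blast
  have \<Theta>'E: "\<Theta>' v r = P r" if "r \<in> ?E" for r
    using that g'_eigen[OF \<open>v \<in> Q\<close>] by (simp add: \<Theta>'_def blinfun.bilinear_simps)
  have lin: "linear (blinfun_apply (\<Theta>' v))"
    by (simp add: bounded_linear.linear blinfun.bounded_linear_right)
  have inj: "inj (blinfun_apply (\<Theta>' v))"
    by (rule bij_is_inj[OF bij_\<Theta>'[OF assms]])
  have "\<Theta>' v ` ?E = ?R"
  proof (rule subspace_dim_equal)
    show "subspace (\<Theta>' v ` ?E)"
      by (rule linear_subspace_image[OF lin subspace_eigen])
    show "subspace ?R"
      unfolding fixed_P_eq by (rule subspace_eigen)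
    show "\<Theta>' v ` ?E \<subseteq> ?R"
      by (auto simp: \<Theta>'E)
    have "dim (\<Theta>' v ` ?E) = dim ?E"
      by (rule dim_image_eq[OF lin]) (use inj in \<open>auto intro: inj_on_subset\<close>)
    then show "dim ?R \<le> dim (\<Theta>' v ` ?E)"
      unfolding fixed_P_eq by (simp add: dim_eigenspace \<open>v \<in> Q\<close> Q(2))
  qed
  then have "\<Theta>' v x \<in> ?R \<longleftrightarrow> x \<in> ?E"
    using inj by (metis (no_types, lifting) inj_image_mem_iff)
  then show ?thesis
    by simp
qed

text \<open>In the chart the derivative of such a \<open>\<phi>\<close> annihilates the range of
  \<open>P\<close>, so along the segment from \<open>\<Theta> v\<close> to \<open>\<Theta> w\<close>
  it sees only \<open>a w - a v\<close>. The slope \<open>s\<close> may be anything above the norm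
  of that derivative at \<open>v0\<close>: a fixed \<open>L\<close> for \<open>l\<close>,
  arbitrarily small for \<open>P\<close> composed with \<open>g\<close>.\<close>

lemma factor_through_a:
  assumes \<phi>: "C1_derivative \<phi> \<phi>' Q"
    and kills: "\<And>v r. v \<in> Q \<Longrightarrow> f' v r = l v *\<^sub>R r \<Longrightarrow> \<phi>' v r = 0"
    and s: "norm (\<phi>' v0 o\<^sub>L \<Psi>' (\<Theta> v0)) < s"
  obtains N where "open N" "v0 \<in> N" "N \<subseteq> W"
    "\<And>v w. v \<in> N \<Longrightarrow> w \<in> N \<Longrightarrow> norm (\<phi> w - \<phi> v) \<le> s * norm (a w - a v)"
proof -
  let ?B = "ball (\<Theta> v0) \<rho>"
  define \<chi>' where "\<chi>' y = \<phi>' (\<Psi> y) o\<^sub>L \<Psi>' y" for y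
  have \<chi>: "C1_derivative (\<lambda>y. \<phi> (\<Psi> y)) \<chi>' ?B"
    unfolding \<chi>'_def \<Psi>'_def
    by (rule C1_derivative_compose[OF \<phi> C1_\<Psi>]) (use \<Psi>_in_W W in blast)
  have \<chi>'P: "\<chi>' y x = \<chi>' y (x - P x)" if "y \<in> ?B" for x y
  proof -
    have "f' (\<Psi> y) (\<Psi>' y (P x)) = l (\<Psi> y) *\<^sub>R \<Psi>' y (P x)"
      using that by (simp add: eigen_iff \<Psi>_in_W \<Theta>'_\<Psi>')
    then have "\<chi>' y (P x) = 0"
      using kills \<Psi>_in_W[OF that] W(2) by (auto simp: \<chi>'_def)
    then show ?thesis
      by (simp add: blinfun.diff_right)
  qed
  have "continuous (at (\<Theta> v0)) \<chi>'"
    using C1_derivativeD(2)[OF \<chi>] \<rho> by (simp add: continuous_on_eq_continuous_at)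
  moreover have "norm (\<chi>' (\<Theta> v0)) < s"
    using s by (simp add: \<chi>'_def \<Psi>\<Theta> W)
  ultimately have "\<forall>\<^sub>F y in at (\<Theta> v0). norm (\<chi>' y) < s"
    by (intro order_tendstoD(2)[OF tendsto_norm]) (simp_all add: continuous_at)
  then obtain d where d: "d > 0" "\<And>y. dist y (\<Theta> v0) < d \<Longrightarrow> norm (\<chi>' y) < s"
    using \<open>norm (\<chi>' (\<Theta> v0)) < s\<close> unfolding eventually_at by (metis UNIV_I)
  let ?b = "ball (\<Theta> v0) (min d \<rho>)"
  show thesis
  proof
    show "open (W \<inter> \<Theta> -` ?b)"
      by (intro continuous_open_preimage homeomorphism_cont1[OF homeo] W) simp
    show "v0 \<in> W \<inter> \<Theta> -` ?b" "W \<inter> \<Theta> -` ?b \<subseteq> W"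
      using W d(1) \<rho> by auto
    fix v w assume v: "v \<in> W \<inter> \<Theta> -` ?b" and w: "w \<in> W \<inter> \<Theta> -` ?b"
    define h where "h = \<Theta> w - \<Theta> v"
    have hP: "h - P h = a w - a v"
      by (simp add: h_def blinfun.diff_right) (simp add: \<Theta>_def)
    define y where "y t = \<Theta> v + t *\<^sub>R h" for t
    have y: "y t \<in> ?b" if "t \<in> {0..1}" for t
    proof -
      have "y t = (1 - t) *\<^sub>R \<Theta> v + t *\<^sub>R \<Theta> w"
        by (simp add: y_def h_def algebra_simps)
      then show ?thesis
        using that v w convexD[OF convex_ball, of "\<Theta> v" "\<Theta> v0" "min d \<rho>" "\<Theta> w" "1 - t" t] by simp
    qed
    have "norm (\<phi> (\<Psi> (y 1)) - \<phi> (\<Psi> (y 0))) \<le> s * norm (a w - a v) * norm (1 - 0 :: real)"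
    proof (rule differentiable_bound[of "{0..1}" "\<lambda>t. \<phi> (\<Psi> (y t))" "\<lambda>t u. \<chi>' (y t) (u *\<^sub>R h)"])
      fix t :: real assume t: "t \<in> {0..1}"
      have "((\<lambda>y. \<phi> (\<Psi> y)) has_derivative \<chi>' (y t)) (at (y t))"
        using C1_derivativeD(1)[OF \<chi>, of "y t"] y[OF t] by simp
      moreover have "(y has_derivative (\<lambda>u. u *\<^sub>R h)) (at t within {0..1})"
        unfolding y_def by (auto intro!: derivative_eq_intros)
      ultimately show "((\<lambda>t. \<phi> (\<Psi> (y t))) has_derivative (\<lambda>u. \<chi>' (y t) (u *\<^sub>R h))) (at t within {0..1})"
        by (rule has_derivative_compose[rotated])
      have "norm (\<chi>' (y t) (u *\<^sub>R h)) \<le> s * norm (a w - a v) * norm u" for u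
      proof -
        have "norm (\<chi>' (y t) h) \<le> norm (\<chi>' (y t)) * norm (h - P h)"
          using \<chi>'P[of "y t" h] y[OF t] norm_blinfun[of "\<chi>' (y t)" "h - P h"] by simp
        also have "\<dots> \<le> s * norm (a w - a v)"
          unfolding hP using d(2)[of "y t"] y[OF t]
          by (intro mult_right_mono) (auto simp: dist_commute)
        finally show ?thesis
          by (simp add: blinfun.scaleR_right mult.commute mult_left_mono)
      qed
      then show "onorm (\<lambda>u. \<chi>' (y t) (u *\<^sub>R h)) \<le> s * norm (a w - a v)"
        by (rule onorm_le)
    qed auto
    moreover have "y 0 = \<Theta> v" "y 1 = \<Theta> w"
      by (simp_all add: y_def h_def)
    ultimately show "norm (\<phi> w - \<phi> v) \<le> s * norm (a w - a v)"
      using v w by (simp add: \<Psi>\<Theta>)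
  qed
qed

end

section \<open>Level sets of \<open>a\<close> as integral manifolds\<close>

context degenerate_chart
begin

definition leaf :: "'a \<Rightarrow> 'a set" where
  "leaf c = {v \<in> W. a v = a c}"

lemma \<Theta>_minus_P: "\<Theta> v - P (\<Theta> v) = a v"
  by (simp add: \<Theta>_def blinfun.add_right)

text \<open>In the chart a leaf is the ball cut by a translate of the fixed space of
  \<open>P\<close>. Connectedness and the submanifold property are read off from this flat
  picture.\<close>

lemma leaf_eq_image: "leaf c = \<Psi> ` {y \<in> ball (\<Theta> v0) \<rho>. y - P y = a c}"
proof (intro equalityI subsetI)
  fix v assume "v \<in> leaf c"
  then show "v \<in> \<Psi> ` {y \<in> ball (\<Theta> v0) \<rho>. y - P y = a c}"
    using \<Psi>\<Theta>[of v] \<Theta>_minus_P[of v] \<Theta>_in_ball[of v]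
    by (intro image_eqI[of _ _ "\<Theta> v"]) (auto simp: leaf_def)
next
  fix v assume "v \<in> \<Psi> ` {y \<in> ball (\<Theta> v0) \<rho>. y - P y = a c}"
  then obtain y where y: "v = \<Psi> y" "y \<in> ball (\<Theta> v0) \<rho>" "y - P y = a c"
    by blast
  then have "a v = a c"
    using \<Theta>_minus_P[of "\<Psi> y"] unfolding \<Theta>\<Psi>[OF y(2)] by simp
  then show "v \<in> leaf c"
    using y \<Psi>_in_W by (simp add: leaf_def)
qed

lemma connected_leaf: "connected (leaf c)"
proof -
  have "{y \<in> ball (\<Theta> v0) \<rho>. y - P y = a c} = ball (\<Theta> v0) \<rho> \<inter> {y. y - P y = a c}"
    by blast
  moreover have "convex {y. y - P y = a c}"
    by (auto simp: convex_def blinfun.bilinear_simps diff_add_eq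
        simp flip: scaleR_left_distrib)
      (metis (no_types, opaque_lifting) add_diff_add scaleR_left.add scaleR_one scaleR_right_diff_distrib)
  ultimately have "connected {y \<in> ball (\<Theta> v0) \<rho>. y - P y = a c}"
    by (simp add: convex_Int convex_connected)
  then show ?thesis
    unfolding leaf_eq_image
    by (rule connected_continuous_image[rotated])
      (rule continuous_on_subset[OF homeomorphism_cont2[OF homeo]], blast)
qed

lemma submanifold_leaf: "submanifold k (leaf c)"
  unfolding submanifold_def
proof (intro ballI exI conjI)
  let ?B = "ball (\<Theta> v0) \<rho>"
  \<comment> \<open>The shift by \<open>a c\<close> moves the affine slice
    \<open>y - P y = a c\<close> to the linear subspace \<open>P r = r\<close>, as
    \<open>submanifold\<close> asks for a subspace.\<close>
  let ?\<Phi> = "\<lambda>v. \<Theta> v - a c" and ?\<Psi> = "\<lambda>y. \<Psi> (y + a c)"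
  let ?B' = "ball (\<Theta> v0 - a c) \<rho>"
  fix v assume "v \<in> leaf c"
  then show "v \<in> W" "open W" "open ?B'"
    by (simp_all add: leaf_def W)
  have in_B: "y \<in> ?B' \<longleftrightarrow> y + a c \<in> ?B" for y
    by (simp add: dist_norm algebra_simps)
  have C1_\<Phi>: "C1_derivative ?\<Phi> \<Theta>' W"
    using C1_derivative_subset[OF C1_\<Theta> W(2)]
    unfolding C1_derivative_def by (auto intro!: derivative_eq_intros)
  have C1_t: "C1_derivative (\<lambda>y. y + a c) (\<lambda>_. id_blinfun) ?B'"
    unfolding C1_derivative_def by (auto intro!: derivative_eq_intros)
  have C1_\<Psi>': "C1_derivative ?\<Psi> (\<lambda>y. \<Psi>' (y + a c) o\<^sub>L id_blinfun) ?B'"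
    unfolding \<Psi>'_def by (rule C1_derivative_compose[OF C1_\<Psi> C1_t]) (use in_B in blast)
  show "homeomorphism W ?B' ?\<Phi> ?\<Psi>"
  proof
    show "continuous_on W ?\<Phi>" "continuous_on ?B' ?\<Psi>"
      by (rule C1_derivative_imp_continuous_on[OF C1_\<Phi>] C1_derivative_imp_continuous_on[OF C1_\<Psi>'])+
    show "?\<Phi> ` W \<subseteq> ?B'" "?\<Psi> ` ?B' \<subseteq> W"
      using \<Theta>_in_ball \<Psi>_in_W in_B by fastforce+
    show "?\<Psi> (?\<Phi> v) = v" if "v \<in> W" for v
      using that by (simp add: \<Psi>\<Theta>)
    show "?\<Phi> (?\<Psi> y) = y" if "y \<in> ?B'" for y
      using that unfolding in_B by (simp only: \<Theta>\<Psi> add_diff_cancel)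
  qed
  show "Ck_on 1 ?\<Phi> W" "Ck_on 1 ?\<Psi> ?B'"
    by (rule C1_derivative_imp_Ck_on_1[OF C1_\<Phi>] C1_derivative_imp_Ck_on_1[OF C1_\<Psi>'])+
  show "subspace {r. P r = r}" "dim {r. P r = r} = k"
    unfolding fixed_P_eq by (simp_all add: subspace_eigen dim_eigenspace Q)
  show "?\<Phi> ` (W \<inter> leaf c) = ?B' \<inter> {r. P r = r}"
  proof (intro equalityI subsetI)
    fix y assume "y \<in> ?\<Phi> ` (W \<inter> leaf c)"
    then obtain v where "v \<in> W" "a v = a c" "y = \<Theta> v - a c"
      by (auto simp: leaf_def)
    then have "y = P v" "y + a c \<in> ?B"
      using \<Theta>_in_ball[of v] by (simp_all add: \<Theta>_def[of v] add.commute)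
    then show "y \<in> ?B' \<inter> {r. P r = r}"
      using in_B by auto
  next
    fix y assume "y \<in> ?B' \<inter> {r. P r = r}"
    then have y: "y + a c \<in> ?B" "P y = y"
      using in_B by auto
    have "(y + a c) - P (y + a c) = a c"
      by (simp add: y blinfun.add_right)
    then have "\<Psi> (y + a c) \<in> leaf c"
      unfolding leaf_eq_image using y(1) by blast
    then show "y \<in> ?\<Phi> ` (W \<inter> leaf c)"
      using \<Theta>\<Psi>[OF y(1)] \<Psi>_in_W[OF y(1)] by (intro image_eqI[of _ _ "\<Psi> (y + a c)"]) auto
  qed
qed

text \<open>A curve in the leaf keeps its transversal chart coordinate constant, so its velocity
  satisfies the criterion \<open>eigen_iff\<close>. Conversely, an eigenvector is the velocity of a
  curve that is a straight line in the chart.\<close>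

lemma tangent_space_leaf:
  assumes "v \<in> leaf c"
  shows "tangent_space (leaf c) v = {r. f' v r = l v *\<^sub>R r}"
proof (intro equalityI subsetI)
  have v: "v \<in> W" "a v = a c" "v \<in> Q"
    using assms W by (auto simp: leaf_def)
  note d\<Theta> = C1_derivativeD(1)[OF C1_\<Theta> v(3)]
  {
    fix w assume "w \<in> tangent_space (leaf c) v"
    then obtain \<gamma> :: "real \<Rightarrow> 'a" where \<gamma>: "\<gamma> 0 = v" "range \<gamma> \<subseteq> leaf c"
      "(\<gamma> has_vector_derivative w) (at 0)"
      by (auto simp: tangent_space_def)
    have d: "((\<lambda>t. \<Theta> (\<gamma> t)) has_derivative (\<lambda>t. \<Theta>' v (t *\<^sub>R w))) (at 0)"
      using has_derivative_compose[OF \<gamma>(3)[unfolded has_vector_derivative_def]] d\<Theta> \<gamma>(1) by blast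
    have "((\<lambda>t. \<Theta> (\<gamma> t) - P (\<Theta> (\<gamma> t))) has_derivative
        (\<lambda>t. \<Theta>' v (t *\<^sub>R w) - P (\<Theta>' v (t *\<^sub>R w)))) (at 0)"
      by (rule has_derivative_diff[OF d blinfun.bounded_linear_right[THEN bounded_linear.has_derivative, OF d]])
    moreover have "(\<lambda>t. \<Theta> (\<gamma> t) - P (\<Theta> (\<gamma> t))) = (\<lambda>_. a c)"
      using \<gamma>(2) by (auto simp only: \<Theta>_minus_P) (auto simp: leaf_def)
    ultimately have "(\<lambda>t. \<Theta>' v (t *\<^sub>R w) - P (\<Theta>' v (t *\<^sub>R w))) = (\<lambda>_. 0)"
      using has_derivative_unique has_derivative_const by metis
    from fun_cong[OF this, of 1] show "w \<in> {r. f' v r = l v *\<^sub>R r}"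
      using eigen_iff[OF v(1), of w] by simp
  }
  {
    fix w assume "w \<in> {r. f' v r = l v *\<^sub>R r}"
    then have w: "P (\<Theta>' v w) = \<Theta>' v w"
      using eigen_iff[OF v(1)] by simp
    let ?B = "ball (\<Theta> v0) \<rho>"
    define y where "y t = \<Theta> v + t *\<^sub>R \<Theta>' v w" for t :: real
    \<comment> \<open>\<open>tangent_space\<close> wants a curve on all of the reals with values in
      the leaf; outside the ball it is parked at \<open>v\<close>, which does not affect the
      derivative at 0.\<close>
    define \<gamma> where "\<gamma> t = (if y t \<in> ?B then \<Psi> (y t) else v)" for t
    have y0: "y 0 = \<Theta> v" "y 0 \<in> ?B"
      using \<Theta>_in_ball[OF v(1)] by (simp_all add: y_def)
    have dy: "(y has_derivative (\<lambda>t. t *\<^sub>R \<Theta>' v w)) (at 0)"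
      unfolding y_def by (auto intro!: derivative_eq_intros)
    have "(\<Psi> has_derivative \<Psi>' (y 0)) (at (y 0))"
      using C1_derivativeD(1)[OF C1_\<Psi> y0(2)] by (simp add: \<Psi>'_def)
    from has_derivative_compose[OF dy this]
    have "((\<lambda>t. \<Psi> (y t)) has_derivative (\<lambda>t. \<Psi>' (y 0) (t *\<^sub>R \<Theta>' v w))) (at 0)" .
    moreover have "\<Psi>' (y 0) (\<Theta>' v w) = w"
      using \<Psi>'_apply[OF y0(2)] bij_\<Theta>'[OF v(1)] by (simp add: y0(1) \<Psi>\<Theta> v(1) bij_is_inj)
    ultimately have d\<Psi>: "((\<lambda>t. \<Psi> (y t)) has_vector_derivative w) (at 0)"
      by (simp add: has_vector_derivative_def blinfun.scaleR_right)
    have "open (y -` ?B)"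
      unfolding y_def by (intro open_vimage continuous_intros) simp
    then have "(\<gamma> has_vector_derivative w) (at 0)"
      by (rule has_vector_derivative_transform_within_open[OF d\<Psi>]) (use y0 in \<open>auto simp: \<gamma>_def\<close>)
    moreover have "\<gamma> 0 = v"
      using y0 by (simp add: \<gamma>_def \<Psi>\<Theta> v(1))
    moreover have "\<gamma> t \<in> leaf c" for t
    proof -
      have "y t - P (y t) = a c"
        by (simp add: y_def blinfun.add_right blinfun.scaleR_right w)
          (simp add: \<Theta>_def v(2))
      then show ?thesis
        using assms unfolding leaf_eq_image \<gamma>_def by auto
    qed
    ultimately show "w \<in> tangent_space (leaf c) v"
      unfolding tangent_space_def by blast
  }
qed

end


section \<open>Estimates for jumps\<close>

lemma C1_derivative_strict:
  fixes f :: "'a::real_normed_vector \<Rightarrow> 'b::real_normed_vector"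
  assumes f: "C1_derivative f f' S" and "open S" "x0 \<in> S" "s > 0"
  obtains r where "r > 0"
    "\<And>v w. v \<in> ball x0 r \<Longrightarrow> w \<in> ball x0 r \<Longrightarrow>
       norm (f w - f v - f' x0 (w - v)) \<le> s * norm (w - v)"
proof -
  have "continuous (at x0) f'"
    using C1_derivativeD(2)[OF f] assms(2,3) by (simp add: continuous_on_eq_continuous_at)
  then have "\<forall>\<^sub>F x in at x0. dist (f' x) (f' x0) < s"
    using \<open>s > 0\<close> by (intro tendstoD) (simp_all add: continuous_at)
  then obtain d where d: "d > 0" "\<And>x. dist x x0 < d \<Longrightarrow> dist (f' x) (f' x0) < s"
    unfolding eventually_at using \<open>s > 0\<close> by (metis UNIV_I dist_self)
  obtain r1 where r1: "r1 > 0" "ball x0 r1 \<subseteq> S"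
    using assms(2,3) open_contains_ball by blast
  show thesis
  proof
    show "min d r1 > 0"
      using d r1 by simp
    fix v w assume vw: "v \<in> ball x0 (min d r1)" "w \<in> ball x0 (min d r1)"
    have "norm ((f w - f' x0 w) - (f v - f' x0 v)) \<le> s * norm (w - v)"
    proof (rule differentiable_bound[of "ball x0 (min d r1)" "\<lambda>x. f x - f' x0 x" "\<lambda>x. f' x - f' x0"])
      fix x assume x: "x \<in> ball x0 (min d r1)"
      then have "x \<in> S"
        using r1 by auto
      note [derivative_intros] = C1_derivativeD(1)[OF f this]
      show "((\<lambda>x. f x - f' x0 x) has_derivative blinfun_apply (f' x - f' x0))
          (at x within ball x0 (min d r1))"
        by (rule has_derivative_at_withinI) (auto intro!: derivative_eq_intros simp: blinfun.diff_left)
      show "onorm (blinfun_apply (f' x - f' x0)) \<le> s"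
      proof -
        have "dist (f' x) (f' x0) < s"
          using d(2)[of x] x by (simp add: dist_commute)
        then show ?thesis
          by (simp add: norm_blinfun.rep_eq[symmetric] dist_norm)
      qed
    qed (use vw in auto)
    then show "norm (f w - f v - f' x0 (w - v)) \<le> s * norm (w - v)"
      by (simp add: blinfun.diff_right algebra_simps)
  qed
qed

context degenerate_chart
begin

text \<open>Near \<open>v0\<close> a jump within a leaf is almost an eigenvector at
  \<open>v0\<close>. Applying the identity minus \<open>P\<close> to the linearisation of
  \<open>\<Theta>\<close> gives \<open>a w - a v\<close> as \<open>\<Theta>' v0\<close> of the
  transversal part, up to an error relative to \<open>w - v\<close>. What matters is that
  \<open>C\<close> is fixed before \<open>s\<close>.\<close>

lemma transversal_estimate:
  obtains C where "C > 0"
    "\<And>s. s > 0 \<Longrightarrow> \<exists>r>0. \<forall>v\<in>ball v0 r. \<forall>w\<in>ball v0 r.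
       norm (w - v - P (w - v)) \<le> C * norm (a w - a v) + s * norm (P (w - v))"
proof -
  have "linear (blinfun_apply (\<Theta>' v0))"
    by (simp add: bounded_linear.linear blinfun.bounded_linear_right)
  then obtain c where c: "c > 0" "\<And>x. c * norm x \<le> norm (\<Theta>' v0 x)"
    using linear_inj_bounded_below_pos inj_\<Theta>'_v0 by blast
  define M where "M = 1 + norm P"
  have M: "M > 0" "norm (x - P x) \<le> M * norm x" for x
    using norm_triangle_ineq4[of x "P x"] norm_blinfun[of P x] norm_ge_zero[of P]
    unfolding M_def distrib_right by linarith+
  show thesis
  proof
    show "2 / c > 0"
      using c by simp
    fix s :: real assume "s > 0"
    \<comment> \<open>The error \<open>M * s1\<close> is made at most \<open>c / 2\<close>, to
      absorb its transversal share into the left side, and at most \<open>s * c / 2\<close>, to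
      leave \<open>s\<close> in front of the eigenspace share.\<close>
    define s1 where "s1 = min 1 s * c / (2 * M)"
    have "s1 > 0"
      using \<open>s > 0\<close> c M by (simp add: s1_def)
    have s1: "M * s1 \<le> c / 2" "M * s1 \<le> s * c / 2"
      using c(1) M(1) by (simp_all add: s1_def mult_le_cancel_right1)
    obtain r where r: "r > 0" "\<And>v w. v \<in> ball v0 r \<Longrightarrow> w \<in> ball v0 r \<Longrightarrow>
       norm (\<Theta> w - \<Theta> v - \<Theta>' v0 (w - v)) \<le> s1 * norm (w - v)"
      using C1_derivative_strict[OF C1_\<Theta> Q \<open>s1 > 0\<close>] by blast
    have "norm (d - P d) \<le> 2 / c * norm (a w - a v) + s * norm (P d)"
      if vw: "v \<in> ball v0 r" "w \<in> ball v0 r" and d: "d = w - v" for v w d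
    proof -
      let ?e = "\<Theta> w - \<Theta> v - \<Theta>' v0 d"
      have "P (\<Theta>' v0 d) = P d"
        using P_range[of d] by (simp add: \<Theta>'_v0 blinfun.add_right)
      moreover have "\<Theta>' v0 (d - P d) = \<Theta>' v0 d - P d"
        by (simp add: blinfun.diff_right) (simp add: \<Theta>'_v0 eigen_P)
      ultimately have "?e - P ?e = (a w - a v) - \<Theta>' v0 (d - P d)"
        by (simp add: blinfun.diff_right \<Theta>_minus_P[symmetric])
      then have "norm ((a w - a v) - \<Theta>' v0 (d - P d)) \<le> M * norm ?e"
        using M(2)[of ?e] by simp
      also have "\<dots> \<le> M * (s1 * norm d)"
        using r(2)[OF vw] M(1) d by (intro mult_left_mono) auto
      finally have "norm ((a w - a v) - \<Theta>' v0 (d - P d)) \<le> M * (s1 * norm d)" .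
      then have "norm (\<Theta>' v0 (d - P d)) \<le> norm (a w - a v) + M * s1 * norm d"
        using norm_triangle_sub[of "\<Theta>' v0 (d - P d)" "a w - a v"]
        by (simp add: norm_minus_commute mult.assoc)
      moreover have "M * s1 * norm d \<le> M * s1 * norm (d - P d) + M * s1 * norm (P d)"
        using M(1) \<open>s1 > 0\<close> norm_triangle_sub[of d "P d"]
        by (simp flip: distrib_left add: add.commute)
      moreover have "M * s1 * norm (d - P d) \<le> c / 2 * norm (d - P d)"
        "M * s1 * norm (P d) \<le> s * c / 2 * norm (P d)"
        using s1 by (intro mult_right_mono; simp)+
      ultimately have "c / 2 * norm (d - P d) \<le> norm (a w - a v) + s * c / 2 * norm (P d)"
        using c(2)[of "d - P d"] by simp
      then show ?thesis
        using c(1) by (simp add: field_simps)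
    qed
    with r(1) show "\<exists>r>0. \<forall>v\<in>ball v0 r. \<forall>w\<in>ball v0 r.
       norm (w - v - P (w - v)) \<le> 2 / c * norm (a w - a v) + s * norm (P (w - v))"
      by blast
  qed
qed

text \<open>All rests on the identity \<open>split\<close>: the residual with speed
  \<open>\<xi>\<close> is the jump of \<open>g\<close>, plus the jump of \<open>l\<close> times the
  small vector \<open>v - v0\<close>, plus \<open>l w - \<xi>\<close> times \<open>w - v\<close>.
  Its transversal part is dominated by the jump of \<open>a\<close>, its \<open>P\<close> part by
  the last term; what remains is a small multiple of these and is absorbed. \<open>C\<close> and
  \<open>\<delta>\<close> precede \<open>D\<close>, which will be chosen in terms of
  \<open>C\<close>.\<close>

lemma jump_estimate:
  obtains C \<delta> where "C > 0" "\<delta> > 0"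
    "\<And>D. D > 0 \<Longrightarrow> \<exists>N. open N \<and> v0 \<in> N \<and> N \<subseteq> W \<and> (\<forall>v\<in>N. \<forall>w\<in>N.
        norm (w - v) \<le> D \<and> \<bar>l w - l v\<bar> \<le> C * norm (a w - a v) \<and>
        (a w = a v \<longrightarrow> f w - f v = l w *\<^sub>R (w - v)) \<and>
        (\<forall>\<xi>. \<bar>l w - \<xi>\<bar> \<le> \<delta> \<longrightarrow>
           norm (a w - a v) \<le> C * norm ((f w - \<xi> *\<^sub>R w) - (f v - \<xi> *\<^sub>R v)) \<and>
           \<bar>l w - \<xi>\<bar> * norm (w - v) \<le> C * norm ((f w - \<xi> *\<^sub>R w) - (f v - \<xi> *\<^sub>R v))))"
proof -
  define M where "M = 1 + norm P"
  have M: "M \<ge> 1" "norm (x - P x) \<le> M * norm x" "norm (P x) \<le> M * norm x" for x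
    using norm_triangle_ineq4[of x "P x"] norm_blinfun[of P x] norm_ge_zero[of P] norm_ge_zero[of x]
    unfolding M_def distrib_right by linarith+
  define L where "L = norm (l' v0 o\<^sub>L \<Psi>' (\<Theta> v0)) + 1"
  have L: "L \<ge> 1" "norm (l' v0 o\<^sub>L \<Psi>' (\<Theta> v0)) < L"
    by (simp_all add: L_def)
  obtain N1 where N1: "open N1" "v0 \<in> N1" "N1 \<subseteq> W"
    "\<And>v w. v \<in> N1 \<Longrightarrow> w \<in> N1 \<Longrightarrow> norm (l w - l v) \<le> L * norm (a w - a v)"
    using factor_through_a[OF l degenerate L(2)] by blast
  obtain C0 where C0: "C0 > 0"
    "\<And>s. s > 0 \<Longrightarrow> \<exists>r>0. \<forall>v\<in>ball v0 r. \<forall>w\<in>ball v0 r.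
       norm (w - v - P (w - v)) \<le> C0 * norm (a w - a v) + s * norm (P (w - v))"
    using transversal_estimate by blast
  \<comment> \<open>\<open>L * M * s = 1/8\<close> is what the term with the jump of
    \<open>l\<close> will cost, relative to the jump of \<open>a\<close>, at distance
    \<open>s\<close> from \<open>v0\<close>. Likewise \<open>\<delta> * C0 = 1/8\<close> will bound
    the share of that jump in the transversal part of the last term.\<close>
  define s where "s = 1 / (8 * L * M)"
  have "L * M \<ge> 1"
    using L(1) M(1) mult_mono[of 1 L 1 M] by simp
  then have s: "s > 0" "s \<le> 1/8" "L * M * s = 1/8"
    by (auto simp: s_def field_simps)
  define C where "C = 4 * L * M"
  have "C > 0" "L \<le> C" "4 * M \<le> C"
    using L(1) M(1) by (simp_all add: C_def)
  define \<delta> where "\<delta> = 1 / (8 * C0)"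
  have \<delta>: "\<delta> > 0" "\<delta> * C0 = 1/8"
    using C0 by (simp_all add: \<delta>_def)

  have C1_Pg: "C1_derivative (\<lambda>v. P (g v)) (\<lambda>v. P o\<^sub>L g' v) Q"
    by (rule C1_derivative_compose[OF _ C1_g, of "blinfun_apply P" "\<lambda>_. P" UNIV])
      (auto simp: C1_derivative_def bounded_linear_imp_has_derivative blinfun.bounded_linear_right)
  \<comment> \<open>At \<open>v0\<close> the derivative of \<open>g\<close> maps into the range that
    \<open>P\<close> annihilates, so the jump of \<open>P g\<close> is bounded by that of
    \<open>a\<close> with as small a slope as desired.\<close>
  have "P (g' v0 x) = 0" for x
    using P_range[of x] by (simp add: g'_apply)
  then have "(P o\<^sub>L g' v0) o\<^sub>L \<Psi>' (\<Theta> v0) = 0"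
    by (intro blinfun_eqI) simp
  then have "norm ((P o\<^sub>L g' v0) o\<^sub>L \<Psi>' (\<Theta> v0)) < s"
    using s(1) by simp
  moreover have "(P o\<^sub>L g' v) r = 0" if "v \<in> Q" "f' v r = l v *\<^sub>R r" for v r
    using that by (simp add: g'_eigen)
  ultimately obtain N2 where N2: "open N2" "v0 \<in> N2" "N2 \<subseteq> W"
    "\<And>v w. v \<in> N2 \<Longrightarrow> w \<in> N2 \<Longrightarrow> norm (P (g w) - P (g v)) \<le> s * norm (a w - a v)"
    using factor_through_a[OF C1_Pg, of s] by blast
  obtain r where r: "r > 0" "\<And>v w. v \<in> ball v0 r \<Longrightarrow> w \<in> ball v0 r \<Longrightarrow>
       norm (w - v - P (w - v)) \<le> C0 * norm (a w - a v) + s * norm (P (w - v))"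
    using C0(2)[OF s(1)] by blast

  show thesis
  proof (rule that[OF \<open>C > 0\<close> \<delta>(1)])
    fix D :: real assume "D > 0"
    define N where "N = N1 \<inter> N2 \<inter> ball v0 (Min {r, s, D / 2})"
    show "\<exists>N. open N \<and> v0 \<in> N \<and> N \<subseteq> W \<and> (\<forall>v\<in>N. \<forall>w\<in>N.
        norm (w - v) \<le> D \<and> \<bar>l w - l v\<bar> \<le> C * norm (a w - a v) \<and>
        (a w = a v \<longrightarrow> f w - f v = l w *\<^sub>R (w - v)) \<and>
        (\<forall>\<xi>. \<bar>l w - \<xi>\<bar> \<le> \<delta> \<longrightarrow>
           norm (a w - a v) \<le> C * norm ((f w - \<xi> *\<^sub>R w) - (f v - \<xi> *\<^sub>R v)) \<and>
           \<bar>l w - \<xi>\<bar> * norm (w - v) \<le> C * norm ((f w - \<xi> *\<^sub>R w) - (f v - \<xi> *\<^sub>R v))))"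
    proof (intro exI[of _ N] conjI ballI allI impI)
      show "open N" "v0 \<in> N" "N \<subseteq> W"
        using N1 N2 r(1) s(1) \<open>D > 0\<close> by (auto simp: N_def)
      fix v w assume "v \<in> N" "w \<in> N"
      then have v: "v \<in> N1" "v \<in> N2" "v \<in> ball v0 r" "norm (v - v0) \<le> s" "v \<in> ball v0 (D / 2)"
        and w: "w \<in> N1" "w \<in> N2" "w \<in> ball v0 r" "w \<in> ball v0 (D / 2)"
        by (auto simp: N_def dist_norm norm_minus_commute)
      show "norm (w - v) \<le> D"
        using v(5) w(4) dist_triangle_half_r[of v0 w D v] by (simp add: dist_norm)
      have dl: "\<bar>l w - l v\<bar> \<le> L * norm (a w - a v)"
        using N1(4)[OF v(1) w(1)] by simp
      also have "\<dots> \<le> C * norm (a w - a v)"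
        using \<open>L \<le> C\<close> by (simp add: mult_right_mono)
      finally show "\<bar>l w - l v\<bar> \<le> C * norm (a w - a v)" .
      have dPg: "norm (P (g w) - P (g v)) \<le> s * norm (a w - a v)"
        using N2(4)[OF v(2) w(2)] .
      have split: "(f w - \<xi> *\<^sub>R w) - (f v - \<xi> *\<^sub>R v) =
        (g w - g v) + (l w - l v) *\<^sub>R (v - v0) + (l w - \<xi>) *\<^sub>R (w - v)" for \<xi>
        by (simp add: g_def algebra_simps)
      \<comment> \<open>On a common leaf \<open>l\<close>, \<open>P g\<close> and hence
        \<open>g\<close> agree; with \<open>\<xi> = l w\<close> the right side of
        \<open>split\<close> vanishes, which is the Rankine-Hugoniot relation.\<close>
      show "f w - f v = l w *\<^sub>R (w - v)" if "a w = a v"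
      proof -
        have "l w = l v" "P (g w) = P (g v)"
          using dl dPg that by simp_all
        moreover from this have "g w = g v"
          using that by (simp add: a_def)
        ultimately show ?thesis
          using split[of "l w"] by (simp add: algebra_simps)
      qed
      fix \<xi> assume \<xi>: "\<bar>l w - \<xi>\<bar> \<le> \<delta>"
      define R where "R = (f w - \<xi> *\<^sub>R w) - (f v - \<xi> *\<^sub>R v)"
      define A where "A = norm (a w - a v)"
      define m where "m = \<bar>l w - \<xi>\<bar>"
      let ?d = "w - v"
      have nonneg: "A \<ge> 0" "m \<ge> 0"
        by (simp_all add: A_def m_def)
      have low: "norm ((l w - l v) *\<^sub>R (x - P x)) \<le> A / 8" "norm ((l w - l v) *\<^sub>R P x) \<le> A / 8"
        if "x = v - v0" for x
      proof -
        have "\<bar>l w - l v\<bar> * y \<le> A / 8" if "y \<le> M * norm x" for y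
        proof -
          have "M * norm x \<le> M * s"
            using v(4) M(1) \<open>x = v - v0\<close> by (intro mult_left_mono) auto
          then have "\<bar>l w - l v\<bar> * y \<le> \<bar>l w - l v\<bar> * (M * s)"
            using that by (intro mult_left_mono) auto
          also have "\<dots> \<le> (L * A) * (M * s)"
            using dl M(1) s(1) unfolding A_def by (intro mult_right_mono) auto
          also have "\<dots> = (L * M * s) * A"
            by simp
          finally show ?thesis
            using s(3) by simp
        qed
        then show "norm ((l w - l v) *\<^sub>R (x - P x)) \<le> A / 8" "norm ((l w - l v) *\<^sub>R P x) \<le> A / 8"
          using M(2,3)[of x] by simp_all
      qed
      have "P R = (P (g w) - P (g v)) + (l w - l v) *\<^sub>R P (v - v0) + (l w - \<xi>) *\<^sub>R P ?d"
        unfolding R_def split by (simp add: blinfun.bilinear_simps)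
      then have "(l w - \<xi>) *\<^sub>R P ?d = P R - (P (g w) - P (g v)) - (l w - l v) *\<^sub>R P (v - v0)"
        by (simp add: algebra_simps)
      then have "m * norm (P ?d) \<le> norm (P R) + s * A + A / 8"
        using low(2)[OF refl] dPg unfolding A_def m_def
        by (metis (no_types, lifting) add_mono norm_scaleR norm_triangle_le_diff order_refl)
      moreover have "s * A \<le> A / 8"
        using s(2) nonneg(1) mult_right_mono[of s "1/8" A] by simp
      ultimately have mP: "m * norm (P ?d) \<le> M * norm R + A / 4"
        using M(3)[of R] by linarith
      have "m * norm (?d - P ?d) \<le> m * (C0 * A + s * norm (P ?d))"
        using r(2)[OF v(3) w(3)] nonneg by (auto simp: A_def intro: mult_left_mono)
      also have "\<dots> = (m * C0) * A + s * (m * norm (P ?d))"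
        by (simp add: algebra_simps)
      also have "\<dots> \<le> 1/8 * A + 1/8 * (m * norm (P ?d))"
      proof (intro add_mono mult_right_mono)
        have "m * C0 \<le> \<delta> * C0"
          using \<xi> C0(1) by (intro mult_right_mono) (auto simp: m_def)
        then show "m * C0 \<le> 1/8"
          using \<delta>(2) by simp
      qed (use s nonneg in auto)
      finally have mD: "m * norm (?d - P ?d) \<le> A / 8 + (m * norm (P ?d)) / 8"
        by simp
      have "R - P R = (a w - a v) + (l w - l v) *\<^sub>R ((v - v0) - P (v - v0)) + (l w - \<xi>) *\<^sub>R (?d - P ?d)"
        unfolding R_def split by (simp add: a_def blinfun.bilinear_simps algebra_simps)
      then have "a w - a v = (R - P R) - (l w - l v) *\<^sub>R ((v - v0) - P (v - v0)) - (l w - \<xi>) *\<^sub>R (?d - P ?d)"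
        by (simp add: algebra_simps)
      then have "A \<le> norm (R - P R) + A / 8 + m * norm (?d - P ?d)"
        using low(1)[OF refl] unfolding A_def m_def
        by (metis (no_types, lifting) add_mono norm_scaleR norm_triangle_le_diff order_refl)
      moreover have MR: "0 \<le> M * norm R"
        using M(1) by simp
      \<comment> \<open>After inserting \<open>mP\<close> and \<open>mD\<close>, the right side
        contains \<open>A\<close> with total coefficient 1/8 + 1/8 + 1/32, which goes to the
        left.\<close>
      ultimately have A: "A \<le> 4 * (M * norm R)"
        using M(2)[of R] mD mP by linarith
      then have "m * norm ?d \<le> 4 * (M * norm R)"
        using mD mP MR mult_left_mono[OF norm_triangle_sub[of ?d "P ?d"] nonneg(2)]
        unfolding distrib_left by linarith
      moreover have "4 * (M * norm R) \<le> C * norm R"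
        using mult_right_mono[OF \<open>4 * M \<le> C\<close>, of "norm R"] by simp
      ultimately show "norm (a w - a v) \<le> C * norm ((f w - \<xi> *\<^sub>R w) - (f v - \<xi> *\<^sub>R v))"
        "\<bar>l w - \<xi>\<bar> * norm (w - v) \<le> C * norm ((f w - \<xi> *\<^sub>R w) - (f v - \<xi> *\<^sub>R v))"
        using A unfolding A_def m_def R_def by linarith+
    qed
  qed
qed

end


section \<open>Self-similar profiles\<close>

definition self_similar_solution ::
  "('a::euclidean_space \<Rightarrow> 'a) \<Rightarrow> (real \<Rightarrow> 'a) \<Rightarrow> bool" where
  "self_similar_solution f V \<longleftrightarrow> V \<in> borel_measurable lebesgue \<and>
    (\<forall>\<xi>1 \<xi>2. \<xi>1 < \<xi>2 \<longrightarrow>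
      (f (V \<xi>2) - \<xi>2 *\<^sub>R V \<xi>2) - (f (V \<xi>1) - \<xi>1 *\<^sub>R V \<xi>1) = - integral {\<xi>1..\<xi>2} V)"

text \<open>Writing \<open>(y - x) V x\<close> as the integral of a constant turns the profile
  equation into a relation with the single speed \<open>y\<close>, up to the integral of
  \<open>V - V x\<close>. So the Rankine-Hugoniot defect is at most oscillation times distance, and
  a better bound on the oscillation improves it.\<close>

lemma rankine_hugoniot_bound:
  fixes V :: "real \<Rightarrow> 'a::euclidean_space" and f :: "'a \<Rightarrow> 'a"
  assumes sol: "self_similar_solution f V" and bound: "\<And>\<xi>. norm (V \<xi>) \<le> K"
    and osc: "\<And>t. t \<in> closed_segment x y \<Longrightarrow> norm (V t - V x) \<le> B"
  shows "norm ((f (V y) - y *\<^sub>R V y) - (f (V x) - y *\<^sub>R V x)) \<le> B * \<bar>y - x\<bar>"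
proof -
  have meas: "V \<in> borel_measurable lebesgue"
    and eq: "\<And>\<xi>1 \<xi>2. \<xi>1 < \<xi>2 \<Longrightarrow>
      (f (V \<xi>2) - \<xi>2 *\<^sub>R V \<xi>2) - (f (V \<xi>1) - \<xi>1 *\<^sub>R V \<xi>1) = - integral {\<xi>1..\<xi>2} V"
    using sol unfolding self_similar_solution_def by blast+
  have int: "V integrable_on {c..d}" for c d
  proof (rule measurable_bounded_by_integrable_imp_integrable)
    show "V \<in> borel_measurable (lebesgue_on {c..d})"
      using meas by (rule measurable_restrict_space1)
  qed (use bound in auto)
  have int_diff: "integral {c..d} (\<lambda>t. V t - V x) = integral {c..d} V - (d - c) *\<^sub>R V x"
    if "c \<le> d" for c d
    using that int by (subst integral_diff) auto
  have bound: "norm (integral {c..d} (\<lambda>t. V t - V x)) \<le> B * (d - c)"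
    if "c \<le> d" "{c..d} \<subseteq> closed_segment x y" for c d
  proof -
    have "B \<ge> 0"
      using osc[of x] norm_ge_zero order_trans by blast
    moreover have "((\<lambda>t. V t - V x) has_integral integral {c..d} (\<lambda>t. V t - V x)) (cbox c d)"
      unfolding cbox_interval
      by (intro integrable_integral integrable_diff int integrable_const_ivl)
    ultimately have "norm (integral {c..d} (\<lambda>t. V t - V x)) \<le> B * Henstock_Kurzweil_Integration.content (cbox c d)"
      by (rule has_integral_bound) (use that(2) osc in auto)
    then show ?thesis
      using that(1) by simp
  qed
  show ?thesis
  proof (cases x y rule: linorder_cases)
    case less
    have "(f (V y) - y *\<^sub>R V y) - (f (V x) - y *\<^sub>R V x) = - integral {x..y} (\<lambda>t. V t - V x)"
      using eq[OF less] less by (simp add: int_diff algebra_simps)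
    then show ?thesis
      using bound[of x y] less by (simp add: closed_segment_eq_real_ivl norm_minus_cancel)
  next
    case greater
    have "(f (V y) - y *\<^sub>R V y) - (f (V x) - y *\<^sub>R V x) = integral {y..x} (\<lambda>t. V t - V x)"
      using eq[OF greater] greater by (simp add: int_diff algebra_simps)
    then show ?thesis
      using bound[of y x] greater by (simp add: closed_segment_eq_real_ivl)
  qed simp
qed

lemma has_derivative_zeroI:
  fixes f :: "real \<Rightarrow> 'a::real_normed_vector"
  assumes "d > 0" and "\<And>y. \<bar>y - x\<bar> < d \<Longrightarrow> norm (f y - f x) \<le> K * \<bar>y - x\<bar>\<^sup>2"
  shows "(f has_derivative (\<lambda>_. 0)) (at x)"
  unfolding has_derivative_iff_norm
proof
  have "((\<lambda>y. K * \<bar>y - x\<bar>) \<longlongrightarrow> K * \<bar>x - x\<bar>) (at x)"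
    by (intro tendsto_intros)
  then have lim: "((\<lambda>y. K * \<bar>y - x\<bar>) \<longlongrightarrow> 0) (at x)"
    by simp
  have "\<forall>\<^sub>F y in at x. norm (norm (f y - f x - 0) / norm (y - x)) \<le> K * \<bar>y - x\<bar>"
    unfolding eventually_at
  proof (intro exI[of _ d] conjI ballI impI)
    fix y assume "y \<noteq> x \<and> dist y x < d"
    then show "norm (norm (f y - f x - 0) / norm (y - x)) \<le> K * \<bar>y - x\<bar>"
      using assms(2)[of y] by (simp add: dist_real_def divide_le_eq power2_eq_square mult.assoc)
  qed fact
  then show "((\<lambda>y. norm (f y - f x - 0) / norm (y - x)) \<longlongrightarrow> 0) (at x)"
    by (rule Lim_null_comparison[OF _ lim])
qed simp

text \<open>The jump estimates along a profile, detached from the chart. In \<open>small\<close>,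
  one factor \<open>C\<close> is spent on passing from the defect to \<open>a\<close> and one from
  \<open>a\<close> to \<open>l\<close>. The speed is \<open>\<xi>2\<close>, and only this point has
  to lie in the sector.\<close>

locale self_similar_profile =
  fixes V :: "real \<Rightarrow> 'a::euclidean_space" and f :: "'a \<Rightarrow> 'a" and l :: "'a \<Rightarrow> real"
    and a :: "'a \<Rightarrow> 'b::real_normed_vector" and \<alpha> \<beta> C D K :: real
  assumes sol: "self_similar_solution f V" and bound: "\<And>\<xi>. norm (V \<xi>) \<le> K"
    and C: "C > 0" and D: "D > 0" and small: "C * C * D \<le> 1/2"
    and diam: "\<And>\<xi>1 \<xi>2. norm (V \<xi>2 - V \<xi>1) \<le> D"
    and lip: "\<And>\<xi>1 \<xi>2. \<bar>l (V \<xi>2) - l (V \<xi>1)\<bar> \<le> C * norm (a (V \<xi>2) - a (V \<xi>1))"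
    and est_a: "\<And>\<xi>1 \<xi>2. \<xi>2 \<in> {\<alpha><..<\<beta>} \<Longrightarrow> norm (a (V \<xi>2) - a (V \<xi>1)) \<le>
      C * norm ((f (V \<xi>2) - \<xi>2 *\<^sub>R V \<xi>2) - (f (V \<xi>1) - \<xi>2 *\<^sub>R V \<xi>1))"
    and est_V: "\<And>\<xi>1 \<xi>2. \<xi>2 \<in> {\<alpha><..<\<beta>} \<Longrightarrow> \<bar>l (V \<xi>2) - \<xi>2\<bar> * norm (V \<xi>2 - V \<xi>1) \<le>
      C * norm ((f (V \<xi>2) - \<xi>2 *\<^sub>R V \<xi>2) - (f (V \<xi>1) - \<xi>2 *\<^sub>R V \<xi>1))"
begin

lemma osc_bound:
  assumes "\<And>t. t \<in> closed_segment x y \<Longrightarrow> norm (V t - V x) \<le> B"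
  shows "norm ((f (V y) - y *\<^sub>R V y) - (f (V x) - y *\<^sub>R V x)) \<le> B * \<bar>y - x\<bar>"
  by (rule rankine_hugoniot_bound[OF sol bound assms])

lemma a_lipschitz:
  assumes "y \<in> {\<alpha><..<\<beta>}"
  shows "norm (a (V y) - a (V x)) \<le> C * D * \<bar>y - x\<bar>"
proof -
  have "norm (a (V y) - a (V x)) \<le> C * norm ((f (V y) - y *\<^sub>R V y) - (f (V x) - y *\<^sub>R V x))"
    by (rule est_a[OF assms])
  also have "\<dots> \<le> C * (D * \<bar>y - x\<bar>)"
    using C by (intro mult_left_mono osc_bound diam) auto
  finally show ?thesis
    by simp
qed

text \<open>As 1/2 is below 1, \<open>l (V \<xi>) = \<xi>\<close> has at most one solution in the
  interval, and \<open>l (V \<xi>) - \<xi>\<close> stays away from zero near a point where it is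
  nonzero.\<close>

lemma l_lipschitz:
  assumes "y \<in> {\<alpha><..<\<beta>}"
  shows "\<bar>l (V y) - l (V x)\<bar> \<le> \<bar>y - x\<bar> / 2"
proof -
  have "\<bar>l (V y) - l (V x)\<bar> \<le> C * norm (a (V y) - a (V x))"
    by (rule lip)
  also have "\<dots> \<le> C * (C * D * \<bar>y - x\<bar>)"
    using C by (intro mult_left_mono a_lipschitz assms) auto
  also have "\<dots> = (C * C * D) * \<bar>y - x\<bar>"
    by simp
  also have "\<dots> \<le> 1/2 * \<bar>y - x\<bar>"
    using small by (intro mult_right_mono) auto
  finally show ?thesis
    by simp
qed

lemma derivative_zero:
  assumes x: "x \<in> {\<alpha><..<\<beta>}" and noncritical: "l (V x) \<noteq> x"
  shows "(V has_derivative (\<lambda>_. 0)) (at x)"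
proof -
  \<comment> \<open>Within distance \<open>m / 2\<close> the quantity \<open>l (V y)\<close> moves
    by at most \<open>m / 4\<close> and \<open>y\<close> by at most \<open>m / 2\<close>, so of the
    initial gap \<open>2 * m\<close> at least \<open>m\<close> remains.\<close>
  define m where "m = \<bar>l (V x) - x\<bar> / 2"
  define d where "d = Min {m / 2, x - \<alpha>, \<beta> - x}"
  have "m > 0" "d > 0" and m: "\<bar>l (V x) - x\<bar> = 2 * m"
    using x noncritical by (auto simp: m_def d_def)
  have near: "y \<in> {\<alpha><..<\<beta>}" "\<bar>l (V y) - y\<bar> \<ge> m" if "\<bar>y - x\<bar> < d" for y
  proof -
    show y: "y \<in> {\<alpha><..<\<beta>}"
      using that by (auto simp: d_def)
    have "\<bar>y - x\<bar> \<le> m / 2"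
      using that by (simp add: d_def)
    then show "\<bar>l (V y) - y\<bar> \<ge> m"
      using l_lipschitz[OF y, of x] abs_triangle_ineq[of "l (V x) - l (V y)" "l (V y) - x"]
        abs_triangle_ineq[of "l (V y) - y" "y - x"] \<open>m > 0\<close> m
      unfolding abs_minus_commute[of "l (V x)" "l (V y)"] by simp
  qed
  have V: "m * norm (V y - V x) \<le> C * (B * \<bar>y - x\<bar>)"
    if "\<bar>y - x\<bar> < d" "\<And>t. t \<in> closed_segment x y \<Longrightarrow> norm (V t - V x) \<le> B" for y B
  proof -
    have "m * norm (V y - V x) \<le> \<bar>l (V y) - y\<bar> * norm (V y - V x)"
      using near(2)[OF that(1)] by (intro mult_right_mono) auto
    also have "\<dots> \<le> C * norm ((f (V y) - y *\<^sub>R V y) - (f (V x) - y *\<^sub>R V x))"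
      by (rule est_V[OF near(1)[OF that(1)]])
    also have "\<dots> \<le> C * (B * \<bar>y - x\<bar>)"
      using C by (intro mult_left_mono osc_bound that) auto
    finally show ?thesis .
  qed
  show ?thesis
  proof (rule has_derivative_zeroI[OF \<open>d > 0\<close>])
    fix y assume y: "\<bar>y - x\<bar> < d"
    \<comment> \<open>The first bound makes \<open>V\<close> Lipschitz at \<open>x\<close>; inserting this as oscillation gains another
      power.\<close>
    have "norm (V t - V x) \<le> C * D / m * \<bar>y - x\<bar>" if "t \<in> closed_segment x y" for t
    proof -
      have t: "\<bar>t - x\<bar> \<le> \<bar>y - x\<bar>"
        using that by (auto simp: closed_segment_eq_real_ivl split: if_splits)
      then have "m * norm (V t - V x) \<le> C * (D * \<bar>t - x\<bar>)"
        using y by (intro V diam) simp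
      also have "\<dots> \<le> C * (D * \<bar>y - x\<bar>)"
        using t C D by (intro mult_left_mono) auto
      finally show ?thesis
        using \<open>m > 0\<close> by (simp add: field_simps)
    qed
    from V[OF y this] have "m * norm (V y - V x) \<le> C * (C * D / m * \<bar>y - x\<bar> * \<bar>y - x\<bar>)" .
    then show "norm (V y - V x) \<le> C * (C * D / m) / m * \<bar>y - x\<bar>\<^sup>2"
      using \<open>m > 0\<close> by (simp add: field_simps power2_eq_square)
  qed
qed

lemma constant_on_noncritical_interval:
  assumes "{u<..<w} \<subseteq> {\<alpha><..<\<beta>}" "\<And>\<xi>. \<xi> \<in> {u<..<w} \<Longrightarrow> l (V \<xi>) \<noteq> \<xi>"
  shows "\<exists>c. \<forall>\<xi>\<in>{u<..<w}. V \<xi> = c"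
proof (rule has_derivative_zero_constant)
  show "(V has_derivative (\<lambda>_. 0)) (at \<xi> within {u<..<w})" if "\<xi> \<in> {u<..<w}" for \<xi>
    by (rule has_derivative_at_withinI[OF derivative_zero]) (use assms that in blast)+
qed simp

text \<open>\<open>V\<close> may jump at \<open>x\<close>, but \<open>a\<close> along
  \<open>V\<close> obeys a Lipschitz bound at \<open>x\<close>, so the constant approached from one
  side shares its \<open>a\<close> with \<open>V x\<close>. The filters used are the one-sided
  ones.\<close>

lemma a_limit:
  assumes x: "x \<in> {\<alpha><..<\<beta>}" and F: "F \<le> at x" "F \<noteq> bot"
    and c: "\<forall>\<^sub>F \<xi> in F. V \<xi> = c"
  shows "a c = a (V x)"
proof -
  have "((\<lambda>y. C * D * \<bar>x - y\<bar>) \<longlongrightarrow> C * D * \<bar>x - x\<bar>) (at x)"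
    by (intro tendsto_intros)
  then have "((\<lambda>y. C * D * \<bar>x - y\<bar>) \<longlongrightarrow> 0) F"
    using tendsto_mono[OF F(1)] by simp
  moreover have "\<forall>\<^sub>F y in F. norm (a (V x) - a c) \<le> C * D * \<bar>x - y\<bar>"
    using c by eventually_elim (metis a_lipschitz[OF x])
  ultimately have "norm (a (V x) - a c) \<le> 0"
    using F(2) by (intro tendsto_lowerbound) auto
  then show ?thesis
    by simp
qed

text \<open>A critical point \<open>\<xi>0\<close> is unique, and \<open>V\<close> is constant on
  either side of it. Both constants share \<open>a\<close>, and therefore \<open>l\<close>, with
  \<open>V \<xi>0\<close>, whatever that value is.\<close>

lemma constant_or_single_jump:
  assumes "\<alpha> < \<beta>"
  shows "(\<exists>c. \<forall>\<xi>\<in>{\<alpha><..<\<beta>}. \<xi> \<noteq> l c \<longrightarrow> V \<xi> = c) \<or>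
    (\<exists>\<xi>0\<in>{\<alpha><..<\<beta>}. \<exists>Vm\<in>range V. \<exists>Vp\<in>range V.
       Vm \<noteq> Vp \<and> a Vm = a Vp \<and> \<xi>0 = l Vm \<and> \<xi>0 = l Vp \<and>
       (\<forall>\<xi>\<in>{\<alpha><..<\<beta>}. \<xi> < \<xi>0 \<longrightarrow> V \<xi> = Vm) \<and> (\<forall>\<xi>\<in>{\<alpha><..<\<beta>}. \<xi> > \<xi>0 \<longrightarrow> V \<xi> = Vp))"
proof (cases "\<exists>\<xi>0\<in>{\<alpha><..<\<beta>}. l (V \<xi>0) = \<xi>0")
  case False
  then have "\<exists>c. \<forall>\<xi>\<in>{\<alpha><..<\<beta>}. V \<xi> = c"
    by (intro constant_on_noncritical_interval) blast+
  then show ?thesis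
    by blast
next
  case True
  then obtain \<xi>0 where \<xi>0: "\<xi>0 \<in> {\<alpha><..<\<beta>}" "l (V \<xi>0) = \<xi>0"
    by blast
  have nc: "l (V \<xi>) \<noteq> \<xi>" if "\<xi> \<in> {\<alpha><..<\<beta>}" "\<xi> \<noteq> \<xi>0" for \<xi>
    using l_lipschitz[OF that(1), of \<xi>0] \<xi>0(2) that(2) by auto
  have "\<exists>c. \<forall>\<xi>\<in>{\<alpha><..<\<xi>0}. V \<xi> = c" "\<exists>c. \<forall>\<xi>\<in>{\<xi>0<..<\<beta>}. V \<xi> = c"
    using nc \<xi>0(1) by (intro constant_on_noncritical_interval; auto)+
  then obtain Vm Vp where Vm: "\<And>\<xi>. \<xi> \<in> {\<alpha><..<\<xi>0} \<Longrightarrow> V \<xi> = Vm"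
    and Vp: "\<And>\<xi>. \<xi> \<in> {\<xi>0<..<\<beta>} \<Longrightarrow> V \<xi> = Vp"
    by blast
  have aVm: "a Vm = a (V \<xi>0)"
  proof (rule a_limit[OF \<xi>0(1)])
    show "\<forall>\<^sub>F \<xi> in at_left \<xi>0. V \<xi> = Vm"
      by (rule eventually_mono[OF eventually_at_left_real[of \<alpha> \<xi>0] Vm]) (use \<xi>0(1) in simp_all)
  qed (simp_all add: at_le)
  have aVp: "a Vp = a (V \<xi>0)"
  proof (rule a_limit[OF \<xi>0(1)])
    show "\<forall>\<^sub>F \<xi> in at_right \<xi>0. V \<xi> = Vp"
      by (rule eventually_mono[OF eventually_at_right_real[of \<xi>0 \<beta>] Vp]) (use \<xi>0(1) in simp_all)
  qed (simp_all add: at_le)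
  have mem: "Vm \<in> range V" "Vp \<in> range V"
    using Vm[of "(\<alpha> + \<xi>0) / 2"] Vp[of "(\<xi>0 + \<beta>) / 2"] \<xi>0(1)
      rangeI[of V "(\<alpha> + \<xi>0) / 2"] rangeI[of V "(\<xi>0 + \<beta>) / 2"] by simp_all
  have crit: "\<xi>0 = l v" if v: "v \<in> range V" "a v = a (V \<xi>0)" for v
  proof -
    obtain y where "v = V y"
      using v(1) by blast
    then show ?thesis
      using v(2) lip[of y \<xi>0] \<xi>0(2) by simp
  qed
  have jump: "a Vm = a Vp" "\<xi>0 = l Vm" "\<xi>0 = l Vp"
    using aVm aVp crit[OF mem(1)] crit[OF mem(2)] by simp_all
  have Vm': "V \<xi> = Vm" if "\<xi> \<in> {\<alpha><..<\<beta>}" "\<xi> < \<xi>0" for \<xi>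
    using Vm that by simp
  have Vp': "V \<xi> = Vp" if "\<xi> \<in> {\<alpha><..<\<beta>}" "\<xi> > \<xi>0" for \<xi>
    using Vp that by simp
  show ?thesis
  proof (cases "Vm = Vp")
    case True
    \<comment> \<open>No jump: the uncontrolled value \<open>V \<xi>0\<close> sits at
      \<open>\<xi>0 = l Vm\<close>, exactly the point that the constant case exempts.\<close>
    then have "V \<xi> = Vm" if "\<xi> \<in> {\<alpha><..<\<beta>}" "\<xi> \<noteq> l Vm" for \<xi>
      using Vm'[of \<xi>] Vp'[of \<xi>] that jump(2) by (metis linorder_neqE)
    then show ?thesis
      by blast
  next
    case False
    then show ?thesis
      by (intro disjI2 bexI[OF _ \<xi>0(1)] bexI[OF _ mem(1)] bexI[OF _ mem(2)] conjI jump ballI impI Vm' Vp')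
  qed
qed

end


section \<open>The structure theorem\<close>

context degenerate_field
begin

text \<open>The leaf is hidden behind an existential \<open>S\<close>, so that the statement can
  leave the local chart in which \<open>leaf\<close> is defined.\<close>

definition constant_or_contact :: "real set \<Rightarrow> (real \<Rightarrow> 'a) \<Rightarrow> bool" where
  "constant_or_contact I V \<longleftrightarrow>
     (\<exists>c. \<forall>\<xi>\<in>I. \<xi> \<noteq> l c \<longrightarrow> V \<xi> = c) \<or>
     (\<exists>\<xi>0\<in>I. \<exists>Vm Vp S.
        Vm \<noteq> Vp \<and> f Vp - f Vm = \<xi>0 *\<^sub>R (Vp - Vm) \<and> \<xi>0 = l Vm \<and> \<xi>0 = l Vp \<and>
        S \<subseteq> Q \<and> connected S \<and> submanifold k S \<and>
        (\<forall>v\<in>S. tangent_space S v = {r. f' v r = l v *\<^sub>R r}) \<and> Vm \<in> S \<and> Vp \<in> S \<and>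
        (\<forall>\<xi>\<in>I. \<xi> < \<xi>0 \<longrightarrow> V \<xi> = Vm) \<and> (\<forall>\<xi>\<in>I. \<xi> > \<xi>0 \<longrightarrow> V \<xi> = Vp))"

text \<open>\<open>N\<close> and \<open>\<delta>\<close> are found before \<open>V\<close> and
  \<open>h\<close>; this is what later allows one threshold for \<open>\<epsilon>\<close> to serve
  all solutions.\<close>

lemma sector_structure:
  obtains N \<delta> where "open N" "v0 \<in> N" "\<delta> > 0"
    "\<And>V h. \<lbrakk>range V \<subseteq> N; self_similar_solution f V; 0 < h; h \<le> \<delta>\<rbrakk> \<Longrightarrow>
       constant_or_contact {l v0 - h <..< l v0 + h} V"
proof -
  obtain W \<rho> \<Psi> where "open W" "W \<subseteq> Q" "v0 \<in> W" "\<rho> > 0" "homeomorphism W (ball (\<Theta> v0) \<rho>) \<Theta> \<Psi>"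
    "\<And>v. v \<in> W \<Longrightarrow> bij (blinfun_apply (\<Theta>' v))"
    "C1_derivative \<Psi> (\<lambda>y. Blinfun (inv (blinfun_apply (\<Theta>' (\<Psi> y))))) (ball (\<Theta> v0) \<rho>)"
    using chart by blast
  then interpret degenerate_chart f f' l l' Q v0 k P W \<rho> \<Psi>
    by unfold_locales
  obtain C \<delta> where C: "C > 0" "\<delta> > 0"
    and est: "\<And>D. D > 0 \<Longrightarrow> \<exists>N. open N \<and> v0 \<in> N \<and> N \<subseteq> W \<and> (\<forall>v\<in>N. \<forall>w\<in>N.
        norm (w - v) \<le> D \<and> \<bar>l w - l v\<bar> \<le> C * norm (a w - a v) \<and>
        (a w = a v \<longrightarrow> f w - f v = l w *\<^sub>R (w - v)) \<and>
        (\<forall>\<xi>. \<bar>l w - \<xi>\<bar> \<le> \<delta> \<longrightarrow>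
           norm (a w - a v) \<le> C * norm ((f w - \<xi> *\<^sub>R w) - (f v - \<xi> *\<^sub>R v)) \<and>
           \<bar>l w - \<xi>\<bar> * norm (w - v) \<le> C * norm ((f w - \<xi> *\<^sub>R w) - (f v - \<xi> *\<^sub>R v))))"
    using jump_estimate by blast
  define D where "D = 1 / (2 * (C * C))"
  have D: "D > 0" "C * C * D \<le> 1/2"
    using C by (simp_all add: D_def)
  obtain N0 where N0: "open N0" "v0 \<in> N0" "N0 \<subseteq> W"
    and est: "\<And>v w. v \<in> N0 \<Longrightarrow> w \<in> N0 \<Longrightarrow> norm (w - v) \<le> D \<and> \<bar>l w - l v\<bar> \<le> C * norm (a w - a v) \<and>
        (a w = a v \<longrightarrow> f w - f v = l w *\<^sub>R (w - v)) \<and>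
        (\<forall>\<xi>. \<bar>l w - \<xi>\<bar> \<le> \<delta> \<longrightarrow>
           norm (a w - a v) \<le> C * norm ((f w - \<xi> *\<^sub>R w) - (f v - \<xi> *\<^sub>R v)) \<and>
           \<bar>l w - \<xi>\<bar> * norm (w - v) \<le> C * norm ((f w - \<xi> *\<^sub>R w) - (f v - \<xi> *\<^sub>R v)))"
    using est[OF D(1)] by blast
  \<comment> \<open>With \<open>l\<close> within \<open>\<delta> / 2\<close> of \<open>l v0\<close>
    and the sector half-width at most \<open>\<delta> / 2\<close>, the distance of
    \<open>l (V \<xi>)\<close> from \<open>\<xi>\<close> is at most \<open>\<delta>\<close>, as the
    jump estimate requires.\<close>
  define N where "N = N0 \<inter> l -` ball (l v0) (\<delta> / 2)"
  have "N \<subseteq> N0" and "N0 \<subseteq> Q"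
    using N0(3) W(2) by (auto simp: N_def)
  then have "open N"
    unfolding N_def
    by (intro continuous_open_preimage N0(1) continuous_on_subset[OF C1_derivative_imp_continuous_on[OF l]]) simp_all
  show thesis
  proof (rule that[of N "\<delta> / 2"])
    show "open N" "v0 \<in> N" "\<delta> / 2 > 0"
      using \<open>open N\<close> N0 C by (simp_all add: N_def)
    fix V :: "real \<Rightarrow> 'a" and h
    assume V: "range V \<subseteq> N" "self_similar_solution f V"
      and h: "0 < h" "h \<le> \<delta> / 2"
    let ?I = "{l v0 - h <..< l v0 + h}"
    have N: "V \<xi> \<in> N" "V \<xi> \<in> N0" for \<xi>
      using V(1) \<open>N \<subseteq> N0\<close> by auto
    have close: "\<bar>l (V \<xi>) - \<xi>\<bar> \<le> \<delta>" if "\<xi> \<in> ?I" for \<xi>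
    proof -
      have "\<bar>l v0 - l (V \<xi>)\<bar> < \<delta> / 2"
        using N(1)[of \<xi>] by (simp add: N_def dist_real_def)
      then show ?thesis
        using that h unfolding abs_less_iff abs_le_iff greaterThanLessThan_iff by linarith
    qed
    interpret self_similar_profile V f l a "l v0 - h" "l v0 + h" C D "norm v0 + D"
    proof
      show "norm (V \<xi>) \<le> norm v0 + D" for \<xi>
        using est[OF N0(2) N(2)[of \<xi>]] norm_triangle_sub[of "V \<xi>" v0] by linarith
      show "norm (V \<xi>2 - V \<xi>1) \<le> D" "\<bar>l (V \<xi>2) - l (V \<xi>1)\<bar> \<le> C * norm (a (V \<xi>2) - a (V \<xi>1))"
        for \<xi>1 \<xi>2
        using est[OF N(2)[of \<xi>1] N(2)[of \<xi>2]] by simp_all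
      show "norm (a (V \<xi>2) - a (V \<xi>1)) \<le>
          C * norm ((f (V \<xi>2) - \<xi>2 *\<^sub>R V \<xi>2) - (f (V \<xi>1) - \<xi>2 *\<^sub>R V \<xi>1))"
        "\<bar>l (V \<xi>2) - \<xi>2\<bar> * norm (V \<xi>2 - V \<xi>1) \<le>
          C * norm ((f (V \<xi>2) - \<xi>2 *\<^sub>R V \<xi>2) - (f (V \<xi>1) - \<xi>2 *\<^sub>R V \<xi>1))"
        if "\<xi>2 \<in> ?I" for \<xi>1 \<xi>2
        using est[OF N(2)[of \<xi>1] N(2)[of \<xi>2]] close[OF that] by blast+
    qed (use V(2) C D in auto)
    have leaf: "Vm \<in> leaf Vm" "Vp \<in> leaf Vm" "f Vp - f Vm = l Vp *\<^sub>R (Vp - Vm)"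
      if "Vm \<in> range V" "Vp \<in> range V" "a Vm = a Vp" for Vm Vp
    proof -
      have "Vm \<in> N0" "Vp \<in> N0"
        using that N(2) by auto
      then show "Vm \<in> leaf Vm" "Vp \<in> leaf Vm" "f Vp - f Vm = l Vp *\<^sub>R (Vp - Vm)"
        using est[of Vm Vp] that(3) N0(3) by (auto simp: leaf_def)
    qed
    have "leaf c \<subseteq> Q" for c
      using W(2) by (auto simp: leaf_def)
    note leaf_props = this connected_leaf submanifold_leaf tangent_space_leaf
    have "l v0 - h < l v0 + h"
      using h(1) by simp
    from constant_or_single_jump[OF this]
    consider "\<exists>c. \<forall>\<xi>\<in>?I. \<xi> \<noteq> l c \<longrightarrow> V \<xi> = c"
      | \<xi>0 Vm Vp where "\<xi>0 \<in> ?I" "Vm \<in> range V" "Vp \<in> range V"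
       "Vm \<noteq> Vp" "a Vm = a Vp" "\<xi>0 = l Vm" "\<xi>0 = l Vp"
       "\<forall>\<xi>\<in>?I. \<xi> < \<xi>0 \<longrightarrow> V \<xi> = Vm" "\<forall>\<xi>\<in>?I. \<xi> > \<xi>0 \<longrightarrow> V \<xi> = Vp"
      by blast
    then show "constant_or_contact ?I V"
    proof cases
      case 1
      then show ?thesis
        unfolding constant_or_contact_def by blast
    next
      case 2
      have "f Vp - f Vm = \<xi>0 *\<^sub>R (Vp - Vm)"
        using leaf(3)[OF 2(2,3,5)] 2(7) by simp
      moreover have "\<forall>v\<in>leaf Vm. tangent_space (leaf Vm) v = {r. f' v r = l v *\<^sub>R r}"
        using tangent_space_leaf by blast
      ultimately show ?thesis
        unfolding constant_or_contact_def using 2 leaf(1,2)[OF 2(2,3,5)] leaf_props(1-3)[of Vm]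
        by (intro disjI2 bexI[OF _ 2(1)] exI[of _ Vm] exI[of _ Vp] exI[of _ "leaf Vm"] conjI)
    qed
  qed
qed

end

section \<open>Passage from \<open>U\<close> to \<open>V = fx U\<close>, and the theorem\<close>

lemma C1_derivative_the_inv_into:
  fixes h :: "'a::euclidean_space \<Rightarrow> 'a"
  assumes h: "C1_derivative h h' S" and "open S" "S \<subseteq> T" "inj_on h T"
    and inj: "\<And>x. x \<in> S \<Longrightarrow> inj (blinfun_apply (h' x))"
  defines "G \<equiv> the_inv_into T h"
  shows "open (h ` S)"
    and "C1_derivative G (\<lambda>y. Blinfun (inv (blinfun_apply (h' (G y))))) (h ` S)"
proof -
  have inj_S: "inj_on h S"
    using assms inj_on_subset by blast
  have G: "G (h x) = x" if "x \<in> S" for x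
    unfolding G_def using assms(3,4) that by (intro the_inv_into_f_f) auto
  show "open (h ` S)"
    by (rule invariance_of_domain[OF C1_derivative_imp_continuous_on[OF h] \<open>open S\<close> inj_S])
  let ?i = "\<lambda>x. Blinfun (inv (blinfun_apply (h' x)))"
  have i: "blinfun_apply (?i x) = inv (blinfun_apply (h' x))" "bij (blinfun_apply (h' x))"
    if "x \<in> S" for x
    using continuous_on_inv_blinfun(2,3)[OF C1_derivativeD(2)[OF h]] inj that by blast+
  have cont_i: "continuous_on S ?i"
    by (rule continuous_on_inv_blinfun(1)[OF C1_derivativeD(2)[OF h] inj])
  have d: "(G has_derivative blinfun_apply (?i x)) (at (h x))" if "x \<in> S" for x
    by (rule has_derivative_inverse_on[OF \<open>open S\<close> C1_derivativeD(1)[OF h] G _ that])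
      (use i[OF that] in \<open>auto simp: fun_eq_iff bij_is_surj surj_f_inv_f\<close>)
  have "continuous_on (h ` S) (\<lambda>y. ?i (G y))"
  proof (rule continuous_on_compose2[OF cont_i])
    show "continuous_on (h ` S) G"
      by (intro continuous_at_imp_continuous_on) (use d has_derivative_continuous in blast)
  qed (use G in auto)
  then show "C1_derivative G (\<lambda>y. ?i (G y)) (h ` S)"
    unfolding C1_derivative_def using d G by auto
qed

lemma eventually_image_cball_subset:
  fixes h :: "'a::metric_space \<Rightarrow> 'b::topological_space"
  assumes "continuous (at x) h" "open N" "h x \<in> N"
  shows "\<forall>\<^sub>F e in at_right 0. h ` cball x e \<subseteq> N"
proof -
  have "\<forall>\<^sub>F y in nhds x. h y \<in> N"
    using assms by (simp add: continuous_at topological_tendstoD eventually_nhds_conv_at)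
  then obtain d where "d > 0" "\<And>y. dist y x < d \<Longrightarrow> h y \<in> N"
    by (auto simp: eventually_nhds_metric)
  then show ?thesis
    unfolding eventually_at_right_field
    by (intro exI[of _ d]) (force simp: dist_commute)
qed

theorem theorem6:
  fixes P :: "(real^'m) set" and fx fy :: "real^'m \<Rightarrow> real^'m"
    and \<eta> \<psi>x \<psi>y :: "real^'m \<Rightarrow> real"
    and Ubar :: "real^'m" and r :: real
    and n :: nat and lam :: "nat \<Rightarrow> real^'m \<Rightarrow> real" and p :: "nat \<Rightarrow> nat"
    and \<delta>s :: "real \<Rightarrow> real"
  defines "f \<equiv> in_V fx (cball Ubar r) fy"
    and "e \<equiv> in_V fx (cball Ubar r) \<psi>x"
    and "q \<equiv> in_V fx (cball Ubar r) \<psi>y"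
    and "Q \<equiv> fx ` ball Ubar r"
  assumes system: "entropy_system P fx fy \<eta> \<psi>x \<psi>y"
    and r: "r > 0" "cball Ubar r \<subseteq> P" "inj_on fx (cball Ubar r)"
    and hyperbolic: "hyperbolic_constant_multiplicity (cball Ubar r) fx fy n lam p"
    and few: "n < CARD('m)"
    and smooth: "\<forall>\<alpha>\<in>{1..n}. smooth_on (lam \<alpha>) Q"
    and dichotomy: "\<forall>\<alpha>\<in>{1..n}. p \<alpha> = 1 \<longrightarrow>
          genuinely_nonlinear Q f (lam \<alpha>) \<or> linearly_degenerate Q f (lam \<alpha>)"
    and definite: "(\<forall>\<mu>\<in>gen_eigenvalues (mat 1) (jacobian fx (at Ubar)). \<mu> > 0) \<or>
          (\<forall>\<mu>\<in>gen_eigenvalues (mat 1) (jacobian fx (at Ubar)). \<mu> < 0)"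
    and sectors: "sector_widths r n (\<lambda>\<alpha>. lam \<alpha> (fx Ubar)) \<delta>s"
  shows "\<exists>\<epsilon>0. 0 < \<epsilon>0 \<and> \<epsilon>0 \<le> r \<and> (\<forall>\<epsilon>. 0 < \<epsilon> \<and> \<epsilon> \<le> \<epsilon>0 \<longrightarrow>
    (\<forall>U V \<sigma> \<alpha>.
       entropy_solution P fx fy \<eta> \<psi>x \<psi>y U \<and> steady_self_similar U \<and>
       range U \<subseteq> cball Ubar \<epsilon> \<and>
       \<sigma> \<in> {1, -1} \<and> half_plane_version \<sigma> fx f e q (fx ` cball Ubar \<epsilon>) U V \<and>
       \<alpha> \<in> {1..n} \<and> linearly_degenerate Q f (lam \<alpha>) \<longrightarrow>
       (let I = sector (lam \<alpha> (fx Ubar)) (\<delta>s \<epsilon>) in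
         constant_on_sector (lam \<alpha>) I V \<or>
         single_contact_on_sector Q f (lam \<alpha>) (p \<alpha>) I V)))"
proof -
  let ?B = "ball Ubar r"
  have "?B \<subseteq> P" "?B \<subseteq> cball Ubar r" "Ubar \<in> ?B"
    using r(1,2) ball_subset_cball by auto
  have "smooth_on fx P" "smooth_on fy P"
    using system by (simp_all add: entropy_system_def)
  then have "Ck_on 1 fx P" "Ck_on 1 fy P"
    unfolding smooth_on_def by blast+
  then obtain fx' fy' where C1P: "C1_derivative fx fx' P" "C1_derivative fy fy' P"
    by (metis Ck_on_1_obtain_C1_derivative)
  then have fx': "C1_derivative fx fx' ?B" and fy': "C1_derivative fy fy' ?B"
    using C1_derivative_subset \<open>?B \<subseteq> P\<close> by blast+
  let ?Fx = "\<lambda>u. jacobian fx (at u)" and ?Fy = "\<lambda>u. jacobian fy (at u)"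
  have jac: "?Fx u *v x = fx' u x" "?Fy u *v x = fy' u x" if "u \<in> ?B" for u x
    using C1_derivativeD(1)[OF fx' that] C1_derivativeD(1)[OF fy' that]
    by (simp_all add: jacobian_def flip: frechet_derivative_at)
      (simp_all add: blinfun.bounded_linear_right bounded_linear.linear matrix_works)
  have hyp: "invertible (?Fx u)" "gen_eigenvalues_semisimple (?Fx u) (?Fy u)"
    "gen_eigenvalues (?Fx u) (?Fy u) = (\<lambda>\<alpha>. lam \<alpha> (fx u)) ` {1..n}"
    "\<And>\<alpha>. \<alpha> \<in> {1..n} \<Longrightarrow> order (lam \<alpha> (fx u)) (pencil_poly (?Fx u) (?Fy u)) = p \<alpha>"
    if "u \<in> ?B" for u
    using hyperbolic \<open>?B \<subseteq> cball Ubar r\<close> that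
    unfolding hyperbolic_constant_multiplicity_def Let_def by blast+
  have inj: "inj (blinfun_apply (fx' u))" if "u \<in> ?B" for u
  proof -
    have "inj ((*v) (?Fx u))"
      using hyp(1)[OF that] by (simp add: inj_matrix_vector_mult)
    moreover have "(*v) (?Fx u) = blinfun_apply (fx' u)"
      using jac(1)[OF that] by blast
    ultimately show ?thesis
      by simp
  qed
  have bij: "bij (blinfun_apply (fx' u))" if "u \<in> ?B" for u
    using continuous_on_inv_blinfun(3)[OF C1_derivativeD(2)[OF fx']] inj that by blast

  \<comment> \<open>The inverse is the one in \<open>in_V\<close>, taken on the closed ball;
    derivatives are formed on the image \<open>Q\<close> of the open ball, which is open by
    invariance of domain.\<close>
  define G where "G = the_inv_into (cball Ubar r) fx"
  have G: "G (fx u) = u" if "u \<in> ?B" for u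
    unfolding G_def using r(3) that by (intro the_inv_into_f_f) auto
  have "open Q"
    and C1_G: "C1_derivative G (\<lambda>V. Blinfun (inv (blinfun_apply (fx' (G V))))) Q"
    using C1_derivative_the_inv_into[OF fx' open_ball \<open>?B \<subseteq> cball Ubar r\<close> r(3) inj]
    unfolding Q_def G_def by blast+
  have "G ` Q \<subseteq> ?B"
    using G by (auto simp: Q_def)
  define f' where "f' V = fy' (G V) o\<^sub>L Blinfun (inv (blinfun_apply (fx' (G V))))" for V
  have f': "C1_derivative f f' Q"
    unfolding f_def in_V_def G_def[symmetric] f'_def
    by (rule C1_derivative_compose[OF fy' C1_G \<open>G ` Q \<subseteq> ?B\<close>])
  have f'_fx': "f' (fx u) (fx' u x) = fy' u x" if "u \<in> ?B" for u x
    using continuous_on_inv_blinfun(2)[OF C1_derivativeD(2)[OF fx']] inj that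
    by (simp add: f'_def G)
  have gen_eigen: "x \<in> gen_eigenspace (?Fx u) (?Fy u) \<mu> \<longleftrightarrow> f' (fx u) (fx' u x) = \<mu> *\<^sub>R fx' u x"
    if "u \<in> ?B" for u x \<mu>
    by (simp add: gen_eigenspace_def matrix_vector_mult_diff_rdistrib jac[OF that] f'_fx'[OF that]
        flip: scaleR_matrix_vector_assoc)

  let ?conclusion = "\<lambda>\<alpha> \<epsilon>. \<forall>U V \<sigma>.
    half_plane_version \<sigma> fx f e q (fx ` cball Ubar \<epsilon>) U V \<longrightarrow>
      constant_on_sector (lam \<alpha>) (sector (lam \<alpha> (fx Ubar)) (\<delta>s \<epsilon>)) V \<or>
      single_contact_on_sector Q f (lam \<alpha>) (p \<alpha>) (sector (lam \<alpha> (fx Ubar)) (\<delta>s \<epsilon>)) V"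
  have "\<forall>\<^sub>F \<epsilon> in at_right 0. ?conclusion \<alpha> \<epsilon>"
    if \<alpha>: "\<alpha> \<in> {1..n}" and ld: "linearly_degenerate Q f (lam \<alpha>)" for \<alpha>
  proof -
    let ?l = "lam \<alpha>" and ?v0 = "fx Ubar"
    have "Ck_on 1 ?l Q"
      using smooth \<alpha> unfolding smooth_on_def by blast
    then obtain l' where l': "C1_derivative ?l l' Q"
      using Ck_on_1_obtain_C1_derivative by blast
    have frechet: "frechet_derivative f (at V) = f' V" "frechet_derivative ?l (at V) = l' V" if "V \<in> Q" for V
      using C1_derivativeD(1)[OF f' that] C1_derivativeD(1)[OF l' that]
      by (metis frechet_derivative_at)+
    have eigenspace: "eigenspace f ?l V = {r. f' V r = ?l V *\<^sub>R r}" if "V \<in> Q" for V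
      by (simp add: eigenspace_def frechet that)
    have dim: "dim {r. f' V r = ?l V *\<^sub>R r} = p \<alpha>" if V: "V \<in> Q" for V
    proof -
      obtain u where u: "u \<in> ?B" "V = fx u"
        using V by (auto simp: Q_def)
      let ?E = "gen_eigenspace (?Fx u) (?Fy u) (?l V)"
      have "{r. f' V r = ?l V *\<^sub>R r} = fx' u ` ?E"
        using gen_eigen[OF u(1)] bij_is_surj[OF bij[OF u(1)]] unfolding u(2)
        by (auto simp: image_iff) (metis surjD)
      moreover have "dim (fx' u ` ?E) = dim ?E"
        by (rule dim_image_eq)
          (use inj[OF u(1)] in \<open>auto intro: inj_on_subset blinfun.bounded_linear_right bounded_linear.linear\<close>)
      moreover have "?l V \<in> gen_eigenvalues (?Fx u) (?Fy u)"
        using hyp(3)[OF u(1)] \<alpha> u(2) by blast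
      then have "dim ?E = p \<alpha>"
        using hyp(2)[OF u(1)] hyp(4)[OF u(1) \<alpha>] u(2)
        by (simp add: gen_eigenvalues_semisimple_def)
      ultimately show ?thesis
        by simp
    qed

    define T where "T x = f' ?v0 x - ?l ?v0 *\<^sub>R x" for x
    have "linear T"
      unfolding T_def
      by (intro linear_compose_sub bounded_linear.linear blinfun.bounded_linear_right bounded_linear_scaleR_right)
    \<comment> \<open>Pulled back by \<open>fx' Ubar\<close>, with \<open>x\<close> and
      \<open>T x\<close> the images of \<open>v\<close> and \<open>w\<close>, the assumption says
      that \<open>v\<close>, \<open>w\<close> form a chain for the matrix pencil, which
      semisimplicity excludes unless \<open>T x = 0\<close>.\<close>
    moreover have "T x = 0" if "T (T x) = 0" for x
    proof -
      let ?A = "?Fy Ubar" and ?B = "?Fx Ubar" and ?\<mu> = "?l (fx Ubar)"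
      have \<mu>: "?\<mu> \<in> gen_eigenvalues ?B ?A"
        using hyp(3)[OF \<open>Ubar \<in> ball Ubar r\<close>] \<alpha> by blast
      obtain v w where v: "fx' Ubar v = x" and w: "fx' Ubar w = T x"
        using bij_is_surj[OF bij[OF \<open>Ubar \<in> ball Ubar r\<close>]] by (metis surjD)
      have "finite (gen_eigenvalues ?B ?A)"
        using hyp(3)[OF \<open>Ubar \<in> ball Ubar r\<close>] by simp
      then have "gen_eigenvalues ?B ?A \<noteq> UNIV"
        using infinite_UNIV_char_0 by metis
      then have "pencil_poly ?B ?A \<noteq> 0"
        by (auto simp: gen_eigenvalues_def simp flip: poly_pencil_poly)
      moreover have "dim (gen_eigenspace ?B ?A ?\<mu>) = order ?\<mu> (pencil_poly ?B ?A)"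
        using hyp(2)[OF \<open>Ubar \<in> ball Ubar r\<close>] \<mu> by (simp add: gen_eigenvalues_semisimple_def)
      moreover have "w \<in> gen_eigenspace ?B ?A ?\<mu>"
        using that gen_eigen[OF \<open>Ubar \<in> ball Ubar r\<close>] w by (simp add: T_def)
      moreover have "(?A - ?\<mu> *\<^sub>R ?B) *v v = ?B *v w"
        using w f'_fx'[OF \<open>Ubar \<in> ball Ubar r\<close>, of v]
        by (simp add: matrix_vector_mult_diff_rdistrib jac[OF \<open>Ubar \<in> ball Ubar r\<close>] T_def v
            flip: scaleR_matrix_vector_assoc)
      ultimately have "?B *v w = 0"
        using semisimple_gen_eigenvalue_transversal by blast
      then show ?thesis
        using w jac(1)[OF \<open>Ubar \<in> ball Ubar r\<close>] by simp
    qed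
    ultimately obtain Pr where Pr: "\<And>x. blinfun_apply Pr (T x) = 0" "\<And>x. T (Pr x) = 0"
        "\<And>x. T x = 0 \<Longrightarrow> Pr x = x"
      using kernel_range_projection by blast

    interpret degenerate_field f f' ?l l' Q ?v0 "p \<alpha>" Pr
    proof
      show "open Q" "?v0 \<in> Q" "C1_derivative f f' Q" "C1_derivative ?l l' Q"
        using \<open>open Q\<close> \<open>Ubar \<in> ?B\<close> f' l' by (auto simp: Q_def)
      show "l' V r = 0" if "V \<in> Q" "f' V r = ?l V *\<^sub>R r" for V r
        using ld that eigenspace[OF that(1)] unfolding linearly_degenerate_def
        by (simp add: frechet)
      show "Pr (f' ?v0 x - ?l ?v0 *\<^sub>R x) = 0" "f' ?v0 (Pr x) = ?l ?v0 *\<^sub>R Pr x" for x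
        using Pr(1,2)[of x] by (simp_all add: T_def)
      show "Pr x = x" if "f' ?v0 x = ?l ?v0 *\<^sub>R x" for x
        using Pr(3)[of x] that by (simp add: T_def)
    qed (rule dim)
    obtain N \<delta> where N: "open N" "?v0 \<in> N" "\<delta> > 0"
      and profile: "\<And>V h. \<lbrakk>range V \<subseteq> N; self_similar_solution f V; 0 < h; h \<le> \<delta>\<rbrakk> \<Longrightarrow>
       constant_or_contact {?l ?v0 - h <..< ?l ?v0 + h} V"
      using sector_structure by blast
    \<comment> \<open>Three demands on \<open>\<epsilon>\<close>: the values of \<open>V\<close> lie
      in \<open>N\<close> by continuity of \<open>fx\<close>, the sector half-width is below
      \<open>\<delta>\<close> since it tends to 0, and \<open>\<epsilon> < r\<close> so that
      \<open>sector_widths\<close> gives a positive width.\<close>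
    have "continuous (at Ubar) fx"
      using C1_derivativeD(1)[OF fx' \<open>Ubar \<in> ?B\<close>] has_derivative_continuous by blast
    then have "\<forall>\<^sub>F \<epsilon> in at_right 0. fx ` cball Ubar \<epsilon> \<subseteq> N"
      by (intro eventually_image_cball_subset N(1,2))
    moreover have "\<forall>\<^sub>F \<epsilon> in at_right 0. \<delta>s \<epsilon> < \<delta>"
      using sectors N(3) unfolding sector_widths_def by (blast intro: order_tendstoD)
    moreover have "\<forall>\<^sub>F \<epsilon> in at_right 0. \<epsilon> \<in> {0<..<r}"
      using eventually_at_right_real[OF r(1)] .
    ultimately show ?thesis
    proof eventually_elim
      case (elim \<epsilon>)
      show ?case
      proof (intro allI impI)
        fix U :: "real \<times> real \<times> real \<Rightarrow> real^'m" and V \<sigma>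
        assume "half_plane_version \<sigma> fx f e q (fx ` cball Ubar \<epsilon>) U V"
        then have V: "range V \<subseteq> N" "self_similar_solution f V"
          using elim(1) unfolding half_plane_version_def self_similar_solution_def by blast+
        have h: "0 < \<delta>s \<epsilon>" "\<delta>s \<epsilon> \<le> \<delta>"
          using sectors elim(2,3) by (simp_all add: sector_widths_def)
        let ?I = "sector (?l ?v0) (\<delta>s \<epsilon>)"
        have "constant_or_contact ?I V"
          unfolding sector_def by (rule profile[OF V h])
        then show "constant_on_sector ?l ?I V \<or> single_contact_on_sector Q f ?l (p \<alpha>) ?I V"
          unfolding constant_or_contact_def
        proof (elim disjE bexE exE conjE)
          show ?thesis if "\<forall>\<xi>\<in>?I. \<xi> \<noteq> ?l c \<longrightarrow> V \<xi> = c" for c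
            using that unfolding constant_on_sector_def by blast
          show ?thesis if jump: "\<xi>0 \<in> ?I" "Vm \<noteq> Vp" "f Vp - f Vm = \<xi>0 *\<^sub>R (Vp - Vm)"
            "\<xi>0 = ?l Vm" "\<xi>0 = ?l Vp"
            and S: "S \<subseteq> Q" "connected S" "submanifold (p \<alpha>) S"
            "\<forall>v\<in>S. tangent_space S v = {r. f' v r = ?l v *\<^sub>R r}" "Vm \<in> S" "Vp \<in> S"
            and sides: "\<forall>\<xi>\<in>?I. \<xi> < \<xi>0 \<longrightarrow> V \<xi> = Vm" "\<forall>\<xi>\<in>?I. \<xi> > \<xi>0 \<longrightarrow> V \<xi> = Vp"
            for \<xi>0 Vm Vp S
          proof -
            have "integral_manifold Q f ?l (p \<alpha>) S"
              using S(1-4) eigenspace unfolding integral_manifold_def by blast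
            then have "same_leaf Q f ?l (p \<alpha>) Vm Vp"
              using S(5,6) unfolding same_leaf_def by blast
            then have "contact_discontinuity Q f ?l (p \<alpha>) \<xi>0 Vm Vp"
              using jump unfolding contact_discontinuity_def by blast
            then show ?thesis
              using jump(1) sides unfolding single_contact_on_sector_def by blast
          qed
        qed
      qed
    qed
  qed
  then have "\<forall>\<^sub>F \<epsilon> in at_right 0. \<forall>\<alpha>\<in>{1..n}. linearly_degenerate Q f (lam \<alpha>) \<longrightarrow> ?conclusion \<alpha> \<epsilon>"
    by (intro eventually_ball_finite) (auto elim: eventually_mono)
  then obtain b where b: "b > 0"
    "\<And>\<epsilon> \<alpha>. \<lbrakk>0 < \<epsilon>; \<epsilon> < b; \<alpha> \<in> {1..n}; linearly_degenerate Q f (lam \<alpha>)\<rbrakk> \<Longrightarrow> ?conclusion \<alpha> \<epsilon>"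
    unfolding eventually_at_right_field by blast
  show ?thesis
  \<comment> \<open>\<open>b\<close> bounds \<open>\<epsilon>\<close> strictly, while the claim
    includes \<open>\<epsilon> = \<epsilon>0\<close>; hence the half.\<close>
  proof (intro exI[of _ "min r (b / 2)"] conjI allI impI)
    fix \<epsilon> U V \<sigma> \<alpha>
    assume "0 < \<epsilon> \<and> \<epsilon> \<le> min r (b / 2)"
      and "entropy_solution P fx fy \<eta> \<psi>x \<psi>y U \<and> steady_self_similar U \<and>
       range U \<subseteq> cball Ubar \<epsilon> \<and>
       \<sigma> \<in> {1, -1} \<and> half_plane_version \<sigma> fx f e q (fx ` cball Ubar \<epsilon>) U V \<and>
       \<alpha> \<in> {1..n} \<and> linearly_degenerate Q f (lam \<alpha>)"
    then show "let I = sector (lam \<alpha> (fx Ubar)) (\<delta>s \<epsilon>) in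
         constant_on_sector (lam \<alpha>) I V \<or>
         single_contact_on_sector Q f (lam \<alpha>) (p \<alpha>) I V"
      using b(2)[of \<epsilon> \<alpha>] b(1) unfolding Let_def by auto
  qed (use r(1) b(1) in auto)
qed

end
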